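(* Let $\Phi:I\times\Sigma\to\mathbb{M}^{n+1}_\kappa$ be a smooth family of two-sided immersions $\Phi_a=\Phi(a,\cdot)$ (not necessarily minimal) of a compact $n$-manifold with boundary, with $\Phi_a(\partial\Sigma)\subset S(r(a))$, where $r$ is a smooth positive function of $a\in I$ ($r<\pi$ if $\kappa=1$). Let $\gamma:I\to(0,\tfrac\pi2]$ be smooth, and suppose that for every $a$, along $\partial\Sigma$, $$\partial_\rho=\sin\gamma(a)\,\eta+\cos\gamma(a)\,\nu_a .$$ Let $\varphi_a=\langle\partial_a\Phi_a,\nu_a\rangle$. Then for every $a\in I$, writing $\gamma=\gamma(a)$, on $\partial\Sigma$, $$\partial_\eta\varphi_a-\Bigl(\frac{\operatorname{ct}_\kappa(r(a))}{\sin\gamma}-\cot\gamma\,A_a(\eta,\eta)\Bigr)\varphi_a=\frac{r'(a)}{\sin\gamma}\Bigl(A_a(\eta,\eta)-\operatorname{ct}_\kappa(r(a))\cos\gamma\Bigr)+\gamma'(a).$$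
   Context: For $\kappa\in\{-1,0,1\}$, $\mathbb{M}^{n+1}_\kappa$ is the complete simply connected space form of constant sectional curvature $\kappa$, with Levi-Civita connection $\overline\nabla$. Fix $p_0$, let $\rho=\operatorname{dist}(p_0,\cdot)$, $\partial_\rho$ its gradient, $S(r)$ the geodesic sphere of radius $r$ centred at $p_0$, and $\operatorname{ct}_\kappa(t)=\coth t,\ 1/t,\ \cot t$ for $\kappa=-1,0,1$. $I\subset\mathbb{R}$ is an interval; $\nu_a$ is a unit normal of $\Phi_a$ chosen smoothly in $a$; $\eta$ is the outward unit conormal of $\partial\Sigma$ in $\Sigma$ for the metric induced by $\Phi_a$; $A_a(X,Y)=\langle\overline\nabla_X\nu_a,Y\rangle$. The hypothesis on $\partial_\rho$ says that the hypersurface meets $S(r(a))$ with $\langle\nu_a,\partial_\rho\rangle=\cos\gamma(a)$. *)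

theory Defs
  imports "HOL-Analysis.Analysis"
begin

section \<open>Smooth maps on subsets of Euclidean spaces\<close>

text \<open>\<open>Ck_on k f W\<close> is only used for open \<open>W\<close>. On an arbitrary set, smooth means: locally the
  restriction of a smooth function on an open set. This covers intervals with endpoints and relatively open
  subsets of a half space.\<close>

primrec Ck_on :: "nat \<Rightarrow> ('a::euclidean_space \<Rightarrow> 'b::real_normed_vector) \<Rightarrow> 'a set \<Rightarrow> bool" where
  "Ck_on 0 f W \<longleftrightarrow> continuous_on W f"
| "Ck_on (Suc k) f W \<longleftrightarrow> (\<forall>x\<in>W. f differentiable (at x)) \<and>
     (\<forall>v. Ck_on k (\<lambda>x. frechet_derivative f (at x) v) W)"

definition smooth_on :: "'a::euclidean_space set \<Rightarrow> ('a \<Rightarrow> 'b::real_normed_vector) \<Rightarrow> bool" where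
  "smooth_on S f \<longleftrightarrow> (\<forall>x\<in>S. \<exists>W g. open W \<and> x \<in> W \<and> (\<forall>k. Ck_on k g W) \<and> (\<forall>y\<in>S \<inter> W. f y = g y))"

section \<open>Smooth manifolds with boundary\<close>

text \<open>The model of an \<open>n\<close>-manifold with boundary is a half space of a Euclidean space \<open>'v\<close> with
  \<open>DIM('v) = n\<close>, bounded by the hyperplane orthogonal to an arbitrary basis vector. A chart is
  a pair of its domain and its coordinate map.\<close>

type_synonym ('m, 'v) chart = "'m set \<times> ('m \<Rightarrow> 'v)"

definition inward :: "'v::euclidean_space" where
  "inward = (SOME b. b \<in> Basis)"

definition half_space :: "'v::euclidean_space set" where
  "half_space = {x. 0 \<le> x \<bullet> inward}"

definition chart_image :: "('m, 'v) chart \<Rightarrow> 'v set" where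
  "chart_image c = snd c ` fst c"

definition chart_inv :: "('m, 'v) chart \<Rightarrow> 'v \<Rightarrow> 'm" where
  "chart_inv c = inv_into (fst c) (snd c)"

definition is_chart :: "'m topology \<Rightarrow> ('m, 'v::euclidean_space) chart \<Rightarrow> bool" where
  "is_chart M c \<longleftrightarrow> openin M (fst c) \<and> openin (top_of_set half_space) (chart_image c) \<and>
     homeomorphic_map (subtopology M (fst c)) (top_of_set (chart_image c)) (snd c)"

definition smooth_manifold_with_boundary ::
  "'m topology \<Rightarrow> ('m, 'v::euclidean_space) chart set \<Rightarrow> bool" where
  "smooth_manifold_with_boundary M A \<longleftrightarrow>
     Hausdorff_space M \<and> second_countable M \<and>
     (\<forall>c\<in>A. is_chart M c) \<and> topspace M = (\<Union>c\<in>A. fst c) \<and>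
     (\<forall>c\<in>A. \<forall>d\<in>A. smooth_on (snd c ` (fst c \<inter> fst d)) (\<lambda>x. snd d (chart_inv c x)))"

definition manifold_boundary :: "('m, 'v::euclidean_space) chart set \<Rightarrow> 'm set" where
  "manifold_boundary A = {p. \<exists>c\<in>A. p \<in> fst c \<and> snd c p \<bullet> inward = 0}"

text \<open>A tangent vector at \<open>p\<close> is given by its coordinates, an element of \<open>'v\<close>, in a preferred chart
  around \<open>p\<close>.\<close>

definition chart_at :: "('m, 'v) chart set \<Rightarrow> 'm \<Rightarrow> ('m, 'v) chart" where
  "chart_at A p = (SOME c. c \<in> A \<and> p \<in> fst c)"

definition differential ::
  "('m, 'v::euclidean_space) chart set \<Rightarrow> ('m \<Rightarrow> 'b::real_normed_vector) \<Rightarrow> 'm \<Rightarrow> 'v \<Rightarrow> 'b" where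
  "differential A f p = (let c = chart_at A p in
     frechet_derivative (\<lambda>x. f (chart_inv c x)) (at (snd c p) within chart_image c))"

definition smooth_family ::
  "real set \<Rightarrow> ('m, 'v::euclidean_space) chart set \<Rightarrow> (real \<Rightarrow> 'm \<Rightarrow> 'b::real_normed_vector) \<Rightarrow> bool" where
  "smooth_family I A F \<longleftrightarrow>
     (\<forall>c\<in>A. smooth_on (I \<times> chart_image c) (\<lambda>(a, x). F a (chart_inv c x)))"

section \<open>The space forms\<close>

text \<open>For \<open>\<kappa> \<in> {-1, 0, 1}\<close> and \<open>DIM('e) = n + 1\<close> the space form is the hypersurface
  \<open>t\<^sup>2 + \<kappa> |x|\<^sup>2 = 1\<close> (with \<open>t > 0\<close> if \<open>\<kappa> \<le> 0\<close>) of \<open>real \<times> 'e\<close> with the metric induced by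
  \<open>\<kappa> dt\<^sup>2 + |dx|\<^sup>2\<close>: the unit sphere, the Euclidean space \<open>{1} \<times> 'e\<close>, or the hyperboloid in
  Minkowski space.\<close>

definition space_form :: "real \<Rightarrow> (real \<times> 'e::euclidean_space) set" where
  "space_form \<kappa> = {p. (fst p)\<^sup>2 + \<kappa> * (norm (snd p))\<^sup>2 = 1 \<and> (\<kappa> \<le> 0 \<longrightarrow> 0 < fst p)}"

definition metric :: "real \<Rightarrow> real \<times> 'e::euclidean_space \<Rightarrow> real \<times> 'e \<Rightarrow> real" where
  "metric \<kappa> u v = \<kappa> * (fst u * fst v) + snd u \<bullet> snd v"

definition tangent_space :: "real \<Rightarrow> real \<times> 'e::euclidean_space \<Rightarrow> (real \<times> 'e) set" where
  "tangent_space \<kappa> p = {v. fst p * fst v + \<kappa> * (snd p \<bullet> snd v) = 0}"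

text \<open>The projection onto the tangent space at \<open>p\<close>. For \<open>\<kappa> = 1\<close> and \<open>\<kappa> = -1\<close>, \<open>p\<close> is a normal
  vector at \<open>p\<close> with \<open>metric \<kappa> p p = \<kappa>\<close>; for \<open>\<kappa> = 0\<close> there is nothing to project.\<close>

definition tangent_proj :: "real \<Rightarrow> real \<times> 'e::euclidean_space \<Rightarrow> real \<times> 'e \<Rightarrow> real \<times> 'e" where
  "tangent_proj \<kappa> p w = w - (\<kappa> * metric \<kappa> w p) *\<^sub>R p"

lemma space_form_0: "space_form 0 = {1} \<times> UNIV"
  by (auto simp: space_form_def power2_eq_1_iff)

lemma space_form_1: "space_form 1 = sphere 0 1"
  by (auto simp: space_form_def norm_prod_def)

lemma metric_self:
  assumes "\<kappa> \<in> {-1, 1}" "p \<in> space_form \<kappa>"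
  shows "metric \<kappa> p p = \<kappa>"
  using assms by (auto simp: space_form_def metric_def power2_eq_square dot_square_norm)

lemma metric_pos:
  assumes "\<kappa> \<in> {-1, 0, 1}" "p \<in> space_form \<kappa>" "v \<in> tangent_space \<kappa> p" "v \<noteq> 0"
  shows "0 < metric \<kappa> v v"
proof -
  obtain t x s y where pv: "p = (t, x)" "v = (s, y)" by (metis surj_pair)
  consider "\<kappa> = 1" | "\<kappa> = 0" | "\<kappa> = -1" using assms(1) by auto
  then show ?thesis
  proof cases
    case 1
    then have "metric \<kappa> v v = v \<bullet> v" by (simp add: metric_def inner_prod_def)
    then show ?thesis using assms(4) by simp
  next
    case 2
    then have "t = 1 \<or> t = -1" "t * s = 0" using assms(2,3) pv
      by (auto simp: space_form_def tangent_space_def power2_eq_1_iff)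
    then have "s = 0" by auto
    then show ?thesis using 2 assms(4) pv by (auto simp: metric_def zero_prod_def)
  next
    case 3
    have t: "t\<^sup>2 = 1 + x \<bullet> x" "0 < t" and ts: "t * s = x \<bullet> y"
      using 3 assms(2,3) pv by (auto simp: space_form_def tangent_space_def dot_square_norm)
    have y: "y \<noteq> 0"
      using ts t(2) assms(4) pv by (auto simp: zero_prod_def)
    have "t\<^sup>2 * s\<^sup>2 = (x \<bullet> y)\<^sup>2" by (metis ts power_mult_distrib)
    also have "\<dots> \<le> (x \<bullet> x) * (y \<bullet> y)" by (rule Cauchy_Schwarz_ineq)
    also have "\<dots> < t\<^sup>2 * (y \<bullet> y)" using t(1) y by (simp add: distrib_right)
    finally have "s\<^sup>2 < y \<bullet> y" using t(2) by simp
    then show ?thesis using 3 pv by (simp add: metric_def power2_eq_square)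
  qed
qed

lemma tangent_proj_in:
  assumes "\<kappa> \<in> {-1, 1}" "p \<in> space_form \<kappa>"
  shows "tangent_proj \<kappa> p w \<in> tangent_space \<kappa> p"
proof -
  have k: "\<kappa> * \<kappa> = 1" using assms(1) by auto
  have *: "fst p * fst u + \<kappa> * (snd p \<bullet> snd u) = \<kappa> * metric \<kappa> u p" for u
    using assms(1) by (auto simp: metric_def inner_commute algebra_simps)
  have "metric \<kappa> (tangent_proj \<kappa> p w) p = metric \<kappa> w p - \<kappa> * metric \<kappa> w p * metric \<kappa> p p"
    by (simp add: tangent_proj_def metric_def inner_diff_left algebra_simps)
  also have "\<dots> = 0" using metric_self[OF assms] k by (simp add: algebra_simps)
  finally show ?thesis by (simp add: tangent_space_def *)
qed

text \<open>The Riemannian distance is the infimum of the lengths of piecewise \<open>C\<^sup>1\<close> curves. The speed of a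
  \<open>valid_path\<close> can be unbounded near a break point; integrability excludes curves of infinite length,
  to which \<open>integral\<close> would assign length 0.\<close>

definition speed :: "real \<Rightarrow> (real \<Rightarrow> real \<times> 'e::euclidean_space) \<Rightarrow> real \<Rightarrow> real" where
  "speed \<kappa> c t = (let v = vector_derivative c (at t) in sqrt (metric \<kappa> v v))"

definition curves_between ::
  "real \<Rightarrow> real \<times> 'e::euclidean_space \<Rightarrow> real \<times> 'e \<Rightarrow> (real \<Rightarrow> real \<times> 'e) set" where
  "curves_between \<kappa> p q = {c. valid_path c \<and> path_image c \<subseteq> space_form \<kappa> \<and>
     pathstart c = p \<and> pathfinish c = q \<and> speed \<kappa> c integrable_on {0..1}}"

definition riem_dist :: "real \<Rightarrow> real \<times> 'e::euclidean_space \<Rightarrow> real \<times> 'e \<Rightarrow> real" where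
  "riem_dist \<kappa> p q = (INF c\<in>curves_between \<kappa> p q. integral {0..1} (speed \<kappa> c))"

definition geodesic_sphere :: "real \<Rightarrow> real \<times> 'e::euclidean_space \<Rightarrow> real \<Rightarrow> (real \<times> 'e) set" where
  "geodesic_sphere \<kappa> p0 s = {q \<in> space_form \<kappa>. riem_dist \<kappa> p0 q = s}"

text \<open>The gradient is the tangent vector representing the differential; the derivative is taken along
  the space form, so only values of \<open>f\<close> on it matter.\<close>

definition gradient :: "real \<Rightarrow> (real \<times> 'e::euclidean_space \<Rightarrow> real) \<Rightarrow> real \<times> 'e \<Rightarrow> real \<times> 'e" where
  "gradient \<kappa> f q =
     (THE G. G \<in> tangent_space \<kappa> q \<and> (f has_derivative metric \<kappa> G) (at q within space_form \<kappa>))"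

definition ct :: "real \<Rightarrow> real \<Rightarrow> real" where
  "ct \<kappa> t = (if \<kappa> = 1 then cot t else if \<kappa> = 0 then 1 / t else cosh t / sinh t)"

section \<open>Hypersurfaces in space forms\<close>

definition immersion ::
  "real \<Rightarrow> 'm topology \<Rightarrow> ('m, 'v::euclidean_space) chart set \<Rightarrow> ('m \<Rightarrow> real \<times> 'e::euclidean_space) \<Rightarrow> bool" where
  "immersion \<kappa> M A F \<longleftrightarrow>
     (\<forall>p\<in>topspace M. F p \<in> space_form \<kappa> \<and> inj (differential A F p))"

definition unit_normal ::
  "real \<Rightarrow> 'm topology \<Rightarrow> ('m, 'v::euclidean_space) chart set \<Rightarrow> ('m \<Rightarrow> real \<times> 'e::euclidean_space) \<Rightarrow>
    ('m \<Rightarrow> real \<times> 'e) \<Rightarrow> bool" where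
  "unit_normal \<kappa> M A F N \<longleftrightarrow> (\<forall>p\<in>topspace M.
     N p \<in> tangent_space \<kappa> (F p) \<and> metric \<kappa> (N p) (N p) = 1 \<and>
     (\<forall>X. metric \<kappa> (N p) (differential A F p X) = 0))"

text \<open>Vectors tangent to the boundary at a boundary point are those orthogonal to \<open>inward\<close> in
  coordinates.\<close>

definition outward_unit_conormal ::
  "real \<Rightarrow> ('m, 'v::euclidean_space) chart set \<Rightarrow> ('m \<Rightarrow> real \<times> 'e::euclidean_space) \<Rightarrow> 'm \<Rightarrow> 'v \<Rightarrow> bool" where
  "outward_unit_conormal \<kappa> A F p \<eta> \<longleftrightarrow>
     metric \<kappa> (differential A F p \<eta>) (differential A F p \<eta>) = 1 \<and>
     (\<forall>X. X \<bullet> inward = 0 \<longrightarrow> metric \<kappa> (differential A F p \<eta>) (differential A F p X) = 0) \<and>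
     \<eta> \<bullet> inward < 0"

text \<open>The Levi-Civita connection of the space form is the tangential part of the flat connection of the
  ambient space, here applied to a vector field \<open>W\<close> along \<open>F\<close>.\<close>

definition cov_deriv ::
  "real \<Rightarrow> ('m, 'v::euclidean_space) chart set \<Rightarrow> ('m \<Rightarrow> real \<times> 'e::euclidean_space) \<Rightarrow>
    ('m \<Rightarrow> real \<times> 'e) \<Rightarrow> 'm \<Rightarrow> 'v \<Rightarrow> real \<times> 'e" where
  "cov_deriv \<kappa> A F W p X = tangent_proj \<kappa> (F p) (differential A W p X)"

definition second_fundamental_form ::
  "real \<Rightarrow> ('m, 'v::euclidean_space) chart set \<Rightarrow> ('m \<Rightarrow> real \<times> 'e::euclidean_space) \<Rightarrow>
    ('m \<Rightarrow> real \<times> 'e) \<Rightarrow> 'm \<Rightarrow> 'v \<Rightarrow> 'v \<Rightarrow> real" where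
  "second_fundamental_form \<kappa> A F N p X Y = metric \<kappa> (cov_deriv \<kappa> A F N p X) (differential A F p Y)"

definition normal_speed ::
  "real \<Rightarrow> real set \<Rightarrow> (real \<Rightarrow> 'm \<Rightarrow> real \<times> 'e::euclidean_space) \<Rightarrow> (real \<Rightarrow> 'm \<Rightarrow> real \<times> 'e) \<Rightarrow>
    real \<Rightarrow> 'm \<Rightarrow> real" where
  "normal_speed \<kappa> I \<Phi> \<nu> a p =
     metric \<kappa> (vector_derivative (\<lambda>b. \<Phi> b p) (at a within I)) (\<nu> a p)"

end

theory Submission
  imports Defs
begin

text \<open>Everything follows from differentiating one scalar identity, the contact angle condition
  \<open>\<langle>\<partial>\<^sub>\<rho>, \<nu>\<rangle> = cos \<gamma>\<close>, along the boundary and in the parameter. Write \<open>X\<close> for the velocity \<open>\<partial>\<^sub>a \<Phi>\<close>.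
  The Hessian of \<open>\<rho>\<close> is \<open>ct(\<rho>)\<close> times the metric on the geodesic sphere.

  In a direction \<open>Y\<close> tangent to the boundary, \<open>Y\<close> is orthogonal to \<open>\<partial>\<^sub>\<rho>\<close> and to \<open>\<nu>\<close>, so the Hessian term vanishes
  and \<open>\<langle>\<partial>\<^sub>\<rho>, \<nabla>\<^sub>Y \<nu>\<rangle> = sin \<gamma> A(Y, \<eta>) = 0\<close>: the conormal is a principal direction (Joachimsthal).
  In the parameter, at a fixed boundary point, \<open>\<langle>X, \<partial>\<^sub>\<rho>\<rangle> = r'\<close>, and the identity gives
  \<open>ct(r) (\<phi> - r' cos \<gamma>) + sin \<gamma> \<langle>\<eta>, \<nabla>\<^sub>a \<nu>\<rangle> = - \<gamma>' sin \<gamma>\<close>.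
  Differentiating \<open>\<langle>\<nu>, d\<Phi>(\<eta>)\<rangle> = 0\<close> in \<open>a\<close> and using that \<open>a\<close>- and space derivatives of \<open>\<Phi>\<close> commute,
  \<open>\<langle>\<eta>, \<nabla>\<^sub>a \<nu>\<rangle> = - \<partial>\<^sub>\<eta> \<phi> + \<langle>X, \<nabla>\<^sub>\<eta> \<nu>\<rangle>\<close>. Finally the tangential part of \<open>X\<close> is \<open>\<langle>X, \<eta>\<rangle> \<eta>\<close> plus a vector
  tangent to the boundary, which \<open>\<nabla>\<^sub>\<eta> \<nu>\<close> does not see because \<open>\<eta>\<close> is principal, and
  \<open>sin \<gamma> \<langle>X, \<eta>\<rangle> = r' - \<phi> cos \<gamma>\<close>. Solving for \<open>\<partial>\<^sub>\<eta> \<phi>\<close> is the claim. This is \<open>robin_condition_local\<close>.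

  The three curvatures are treated at once by expressing the distance through the ambient squared chord
  \<open>\<langle>q - p, q - p\<rangle> = 4 sn(\<rho>/2)\<^sup>2\<close>, where \<open>sn\<close> is \<open>sin\<close>, the identity or \<open>sinh\<close>. To connect this with the distance
  defined as an infimum of lengths, \<open>riem_dist_eq\<close> compares curves with geodesics from above and
  with calibrating functions of the chord from below; \<open>gradient_riem_dist\<close> then gives
  \<open>\<partial>\<^sub>\<rho> = (cs(\<rho>) q - p) / sn(\<rho>)\<close>. So the contact angle condition is an equation between
  \<open>cs(r) \<Phi> - p\<close> and \<open>\<nu>\<close>, and no derivative of \<open>\<partial>\<^sub>\<rho>\<close> is needed.

  Two facts about charts remain. The conditions at nearby points are stated in other charts, but
  transition maps turn them into conditions in one chart (\<open>differential_chart\<close>); and a boundary point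
  has boundary coordinates in every chart (\<open>boundary_chart_independent\<close>).\<close>

section \<open>Derivatives along accumulating directions\<close>

text \<open>The domains of interest are products of an interval, possibly with endpoints, and a relatively
  open piece of a half space or of its boundary hyperplane. If such a set \<open>S\<close> accumulates at \<open>y\<close> along \<open>v\<close>,
  a derivative at \<open>y\<close> in direction \<open>v\<close> is determined by the values on \<open>S\<close>. The parameter \<open>t\<close> may have either sign,
  so every direction qualifies at a boundary point of a half space.\<close>

definition accumulates_along :: "'a::real_normed_vector set \<Rightarrow> 'a \<Rightarrow> 'a \<Rightarrow> bool" where
  "accumulates_along S y v \<longleftrightarrow> (\<forall>e>0. \<exists>t. t \<noteq> 0 \<and> \<bar>t\<bar> < e \<and> y + t *\<^sub>R v \<in> S)"

lemma derivative_eq_along: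
  assumes f: "(f has_derivative f') (at y within S)" and g: "(g has_derivative g') (at y within S)"
    and v: "accumulates_along S y v" and eq: "\<And>x. x \<in> S \<Longrightarrow> f x = g x" and "f y = g y"
  shows "f' v = g' v"
proof (rule ccontr)
  assume ne: "f' v \<noteq> g' v"
  define h' where "h' x = f' x - g' x" for x
  have h: "((\<lambda>x. f x - g x) has_derivative h') (at y within S)"
    unfolding h'_def by (rule has_derivative_diff[OF f g])
  then have lin: "linear h'" by (rule has_derivative_linear)
  define \<epsilon> where "\<epsilon> = norm (h' v) / (2 * (norm v + 1))"
  have pos: "norm (h' v) > 0" using ne by (simp add: h'_def)
  then have "\<epsilon> > 0"
    unfolding \<epsilon>_def by (intro divide_pos_pos) (auto intro: add_nonneg_pos)
  then obtain d where d: "d > 0"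
    "\<And>x. x \<in> S \<Longrightarrow> norm (x - y) < d \<Longrightarrow>
       norm ((f x - g x) - (f y - g y) - h' (x - y)) \<le> \<epsilon> * norm (x - y)"
    using h unfolding has_derivative_within_alt by blast
  have "d / (norm v + 1) > 0"
    using d by (intro divide_pos_pos) (auto intro: add_nonneg_pos)
  then obtain t where t: "t \<noteq> 0" "\<bar>t\<bar> < d / (norm v + 1)" "y + t *\<^sub>R v \<in> S"
    using v unfolding accumulates_along_def by meson
  have "\<bar>t\<bar> * norm v \<le> \<bar>t\<bar> * (norm v + 1)" by (simp add: mult_left_mono)
  also have "\<dots> < d"
    using t(2) by (subst (asm) pos_less_divide_eq) (auto intro: add_nonneg_pos)
  finally have "norm (t *\<^sub>R h' v) \<le> \<epsilon> * norm (t *\<^sub>R v)"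
    using d(2)[OF t(3)] eq[OF t(3)] \<open>f y = g y\<close> by (simp add: linear_scale[OF lin])
  then have "norm (h' v) \<le> \<epsilon> * norm v"
    using t(1) by (simp add: mult.left_commute)
  also have "\<dots> < \<epsilon> * (2 * (norm v + 1))"
  proof (rule mult_strict_left_mono[OF _ \<open>\<epsilon> > 0\<close>])
    have "0 < norm v + 2" by (rule add_nonneg_pos) auto
    then show "norm v < 2 * (norm v + 1)" by simp
  qed
  also have "\<dots> = norm (h' v)"
  proof -
    have "norm v + 1 > 0" by (rule add_nonneg_pos) auto
    then have "2 * (norm v + 1) \<noteq> 0" by simp
    then show ?thesis unfolding \<epsilon>_def by simp
  qed
  finally show False by simp
qed

lemma accumulates_along_mono: "accumulates_along S y v \<Longrightarrow> S \<subseteq> T \<Longrightarrow> accumulates_along T y v"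
  unfolding accumulates_along_def by blast

lemma accumulates_along_open_Int:
  assumes "accumulates_along S y v" "open W" "y \<in> W"
  shows "accumulates_along (S \<inter> W) y v"
  unfolding accumulates_along_def
proof (intro allI impI)
  fix e :: real assume "e > 0"
  have "((\<lambda>t. y + t *\<^sub>R v) \<longlongrightarrow> y + 0 *\<^sub>R v) (at 0)"
    by (intro tendsto_intros)
  then have "\<forall>\<^sub>F t in at 0. y + t *\<^sub>R v \<in> W"
    using assms(2,3) by (auto dest: topological_tendstoD)
  then obtain d where d: "d > 0" "\<And>t. t \<noteq> 0 \<Longrightarrow> \<bar>t\<bar> < d \<Longrightarrow> y + t *\<^sub>R v \<in> W"
    unfolding eventually_at by (auto simp: dist_real_def)
  have "min e d > 0" using \<open>e > 0\<close> d by simp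
  then obtain t where "t \<noteq> 0" "\<bar>t\<bar> < min e d" "y + t *\<^sub>R v \<in> S"
    using assms(1) unfolding accumulates_along_def by meson
  then show "\<exists>t. t \<noteq> 0 \<and> \<bar>t\<bar> < e \<and> y + t *\<^sub>R v \<in> S \<inter> W" using d by auto
qed

lemma frechet_derivative_within_eqI:
  assumes f: "(f has_derivative f') (at y within S)" and S: "\<And>v. accumulates_along S y v"
  shows "frechet_derivative f (at y within S) = f'"
proof
  fix v
  have "(f has_derivative frechet_derivative f (at y within S)) (at y within S)"
    using f frechet_derivative_works differentiable_def by blast
  from derivative_eq_along[OF this f S] show "frechet_derivative f (at y within S) v = f' v" by simp
qed

lemma accumulates_along_Pair_left: "accumulates_along I a v \<Longrightarrow> x \<in> C \<Longrightarrow> accumulates_along (I \<times> C) (a, x) (v, 0)"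
  unfolding accumulates_along_def by auto

lemma accumulates_along_Pair_right: "accumulates_along C x v \<Longrightarrow> a \<in> I \<Longrightarrow> accumulates_along (I \<times> C) (a, x) (0, v)"
  unfolding accumulates_along_def by auto

lemma accumulates_along_interval:
  fixes I :: "real set"
  assumes "is_interval I" "interior I \<noteq> {}" "a \<in> I"
  shows "accumulates_along I a 1"
  unfolding accumulates_along_def
proof (intro allI impI)
  fix e :: real assume "e > 0"
  have "I \<noteq> {a}" using assms(2) by auto
  then obtain b where b: "b \<in> I" "b \<noteq> a" using assms(3) by auto
  define l where "l = min 1 (e / (2 * \<bar>b - a\<bar>))"
  have l: "0 < l" "l \<le> 1" using \<open>e > 0\<close> b by (auto simp: l_def)
  have "l * \<bar>b - a\<bar> \<le> e / (2 * \<bar>b - a\<bar>) * \<bar>b - a\<bar>" by (intro mult_right_mono) (auto simp: l_def)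
  also have "\<dots> < e" using b \<open>e > 0\<close> by simp
  finally have s: "\<bar>l * (b - a)\<bar> < e" using l by (simp add: abs_mult)
  have "convex I" using assms(1) by (simp add: is_interval_convex)
  then have "(1 - l) *\<^sub>R a + l *\<^sub>R b \<in> I" using b assms(3) l unfolding convex_alt by auto
  then have "a + l * (b - a) \<in> I" by (simp add: algebra_simps)
  then show "\<exists>t. t \<noteq> 0 \<and> \<bar>t\<bar> < e \<and> a + t *\<^sub>R 1 \<in> I" using s l b
    by (intro exI[of _ "l * (b - a)"]) auto
qed

lemma accumulates_along_half_space:
  fixes x v :: "'v::euclidean_space"
  assumes "openin (top_of_set half_space) C" "x \<in> C"
  shows "accumulates_along C x v"
proof -
  obtain W where W: "open W" "C = half_space \<inter> W" using assms(1) by (auto simp: openin_open)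
  have x: "0 \<le> x \<bullet> inward" using assms(2) W by (auto simp: half_space_def)
  have "accumulates_along half_space x v" unfolding accumulates_along_def
  proof (intro allI impI)
    fix e :: real assume "e > 0"
    define t where "t = (if 0 \<le> v \<bullet> inward then e / 2 else - e / 2)"
    have "0 \<le> t * (v \<bullet> inward)" using \<open>e > 0\<close> by (auto simp: t_def mult_nonneg_nonpos)
    then have "x + t *\<^sub>R v \<in> half_space" using x by (simp add: half_space_def inner_add_left)
    then show "\<exists>t. t \<noteq> 0 \<and> \<bar>t\<bar> < e \<and> x + t *\<^sub>R v \<in> half_space"
      using \<open>e > 0\<close> by (intro exI[of _ t]) (auto simp: t_def)
  qed
  then show ?thesis unfolding W(2) using W assms(2) by (intro accumulates_along_open_Int) auto
qed

lemma accumulates_along_boundary: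
  fixes x v :: "'v::euclidean_space"
  assumes "openin (top_of_set half_space) C" "x \<in> C" "x \<bullet> inward = 0" "v \<bullet> inward = 0"
  shows "accumulates_along {z \<in> C. z \<bullet> inward = 0} x v"
proof -
  obtain W where W: "open W" "C = half_space \<inter> W" using assms(1) by (auto simp: openin_open)
  have "accumulates_along {z. z \<bullet> inward = 0} x v" unfolding accumulates_along_def
  proof (intro allI impI)
    fix e :: real assume "e > 0"
    then show "\<exists>t. t \<noteq> 0 \<and> \<bar>t\<bar> < e \<and> x + t *\<^sub>R v \<in> {z. z \<bullet> inward = 0}"
      using assms(3,4) by (intro exI[of _ "e / 2"]) (auto simp: inner_add_left)
  qed
  then have "accumulates_along ({z. z \<bullet> inward = 0} \<inter> W) x v" using W assms(2) by (intro accumulates_along_open_Int) auto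
  then show ?thesis by (rule accumulates_along_mono) (auto simp: W half_space_def)
qed

lemma accumulates_along_not_bot:
  fixes I :: "real set"
  assumes "accumulates_along I a 1"
  shows "at a within I \<noteq> bot"
proof -
  have "\<exists>x\<in>I. x \<noteq> a \<and> dist x a < e" if e: "e > 0" for e
  proof -
    obtain t where "t \<noteq> 0" "\<bar>t\<bar> < e" "a + t *\<^sub>R 1 \<in> I" using assms e unfolding accumulates_along_def by blast
    then show ?thesis by (intro bexI[of _ "a + t"]) (auto simp: dist_real_def)
  qed
  then have "a islimpt I" by (auto simp: islimpt_approachable)
  then show ?thesis by (simp add: trivial_limit_within)
qed

section \<open>Symmetry of second derivatives\<close>

text \<open>The mean value theorem in direction \<open>u\<close> reduces the second difference to a difference of first
  derivatives, for which differentiability at the single point \<open>y\<close> suffices. The second difference is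
  symmetric in \<open>u\<close> and \<open>v\<close>, hence so is its limit.\<close>

lemma second_difference_limit:
  fixes f :: "'a::real_normed_vector \<Rightarrow> real"
  assumes "open W" "y \<in> W"
    and f: "\<And>x. x \<in> W \<Longrightarrow> (f has_derivative f' x) (at x)"
    and L: "((\<lambda>x. f' x u) has_derivative L) (at y)"
  shows "((\<lambda>h. (f (y + h *\<^sub>R u + h *\<^sub>R v) - f (y + h *\<^sub>R u) - f (y + h *\<^sub>R v) + f y) / h\<^sup>2) \<longlongrightarrow> L v)
           (at_right 0)"
    (is "(?q \<longlongrightarrow> _) _")
proof (rule tendstoI)
  fix e :: real assume "e > 0"
  define K where "K = norm u + norm v + 1"
  have K: "K > 0" "norm u + norm v < K" unfolding K_def by (auto intro: add_nonneg_pos)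
  define \<epsilon> where "\<epsilon> = e / (4 * K)"
  have "\<epsilon> > 0" using \<open>e > 0\<close> K by (simp add: \<epsilon>_def)
  have lin: "linear L" using L by (rule has_derivative_linear)
  obtain d1 where d1: "d1 > 0"
    "\<And>x. norm (x - y) < d1 \<Longrightarrow> norm (f' x u - f' y u - L (x - y)) \<le> \<epsilon> * norm (x - y)"
    using L \<open>\<epsilon> > 0\<close> unfolding has_derivative_within_alt by (meson UNIV_I)
  obtain d2 where d2: "d2 > 0" "ball y d2 \<subseteq> W" using assms(1,2) open_contains_ball by blast
  define d where "d = min d1 d2"
  have "d > 0" using d1 d2 by (simp add: d_def)
  have main: "dist (?q h) (L v) < e" if h: "0 < h" "h < d / K" for h
  proof -
    have hK: "h * K < d" using h K by (simp add: pos_less_divide_eq)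
    have small: "norm (s *\<^sub>R u + t *\<^sub>R v) \<le> h * K" if "0 \<le> s" "s \<le> h" "0 \<le> t" "t \<le> h" for s t
    proof -
      have "norm (s *\<^sub>R u + t *\<^sub>R v) \<le> s * norm u + t * norm v"
        using norm_triangle_ineq[of "s *\<^sub>R u" "t *\<^sub>R v"] that by simp
      also have "\<dots> \<le> h * norm u + h * norm v"
        using that by (intro add_mono mult_right_mono) auto
      also have "\<dots> \<le> h * K" using K h by (simp add: distrib_left[symmetric])
      finally show ?thesis .
    qed
    have inW: "y + s *\<^sub>R u + t *\<^sub>R v \<in> W" if "0 \<le> s" "s \<le> h" "0 \<le> t" "t \<le> h" for s t
    proof -
      have "dist (y + (s *\<^sub>R u + t *\<^sub>R v)) y < d2"
        using small[OF that] hK by (simp add: dist_norm d_def)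
      then show ?thesis using d2 by (auto simp: add.assoc dist_commute)
    qed
    have approx: "\<bar>f' (y + s *\<^sub>R u + t *\<^sub>R v) u - f' y u - L (s *\<^sub>R u + t *\<^sub>R v)\<bar> \<le> \<epsilon> * (h * K)"
      if "0 \<le> s" "s \<le> h" "0 \<le> t" "t \<le> h" for s t
    proof -
      have "norm (f' (y + (s *\<^sub>R u + t *\<^sub>R v)) u - f' y u - L ((y + (s *\<^sub>R u + t *\<^sub>R v)) - y))
          \<le> \<epsilon> * norm ((y + (s *\<^sub>R u + t *\<^sub>R v)) - y)"
        by (rule d1(2)) (use small[OF that] hK in \<open>simp add: d_def\<close>)
      also have "\<dots> \<le> \<epsilon> * (h * K)" using small[OF that] \<open>\<epsilon> > 0\<close> by (intro mult_left_mono) auto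
      finally show ?thesis by (simp add: add.assoc)
    qed
    define \<psi> where "\<psi> s = f (y + s *\<^sub>R u + h *\<^sub>R v) - f (y + s *\<^sub>R u + 0 *\<^sub>R v)" for s
    have dl: "((\<lambda>s. f (y + s *\<^sub>R u + t *\<^sub>R v)) has_real_derivative f' (y + s *\<^sub>R u + t *\<^sub>R v) u) (at s)"
      if "0 \<le> s" "s \<le> h" "0 \<le> t" "t \<le> h" for s t
    proof -
      have "((\<lambda>s. y + s *\<^sub>R u + t *\<^sub>R v) has_derivative (\<lambda>s. s *\<^sub>R u)) (at s)"
        by (auto intro!: derivative_eq_intros)
      from has_derivative_compose[OF this f[OF inW[OF that]]]
      have "((\<lambda>s. f (y + s *\<^sub>R u + t *\<^sub>R v)) has_derivative (\<lambda>r. f' (y + s *\<^sub>R u + t *\<^sub>R v) (r *\<^sub>R u))) (at s)" .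
      moreover have "linear (f' (y + s *\<^sub>R u + t *\<^sub>R v))"
        using f[OF inW[OF that]] by (rule has_derivative_linear)
      ultimately show ?thesis
        by (simp add: has_field_derivative_def linear_scale mult.commute[of _ "f' _ _"])
    qed
    have "\<exists>z. 0 < z \<and> z < h \<and> \<psi> h - \<psi> 0 =
        (h - 0) * (f' (y + z *\<^sub>R u + h *\<^sub>R v) u - f' (y + z *\<^sub>R u + 0 *\<^sub>R v) u)"
      unfolding \<psi>_def by (rule MVT2[OF h(1)], rule DERIV_diff; rule dl) (use h in auto)
    then obtain z where z: "0 < z" "z < h" and eq: "\<psi> h - \<psi> 0 =
        h * (f' (y + z *\<^sub>R u + h *\<^sub>R v) u - f' (y + z *\<^sub>R u + 0 *\<^sub>R v) u)" by auto
    have Lv: "h * L v = L (z *\<^sub>R u + h *\<^sub>R v) - L (z *\<^sub>R u + 0 *\<^sub>R v)"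
      by (simp add: linear_add[OF lin] linear_scale[OF lin])
    have q: "?q h = (f' (y + z *\<^sub>R u + h *\<^sub>R v) u - f' (y + z *\<^sub>R u + 0 *\<^sub>R v) u) / h"
      using eq h by (simp add: \<psi>_def power2_eq_square divide_simps) algebra
    have "\<bar>(f' (y + z *\<^sub>R u + h *\<^sub>R v) u - f' (y + z *\<^sub>R u + 0 *\<^sub>R v) u) - h * L v\<bar> \<le> 2 * (\<epsilon> * (h * K))"
    proof -
      have a: "\<bar>f' (y + z *\<^sub>R u + h *\<^sub>R v) u - f' y u - L (z *\<^sub>R u + h *\<^sub>R v)\<bar> \<le> \<epsilon> * (h * K)"
        "\<bar>f' (y + z *\<^sub>R u + 0 *\<^sub>R v) u - f' y u - L (z *\<^sub>R u + 0 *\<^sub>R v)\<bar> \<le> \<epsilon> * (h * K)"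
        by (rule approx; use z h in simp)+
      show ?thesis using a unfolding Lv by linarith
    qed
    then have "\<bar>?q h * h - h * L v\<bar> \<le> 2 * (\<epsilon> * (h * K))" unfolding q using h by simp
    then have "h * \<bar>?q h - L v\<bar> \<le> h * (2 * \<epsilon> * K)"
      using h by (simp add: abs_mult[of h, symmetric, simplified] right_diff_distrib mult.commute mult.left_commute abs_mult_pos' del: mult_le_cancel_left)
    then have "\<bar>?q h - L v\<bar> \<le> 2 * \<epsilon> * K" using h by simp
    also have "\<dots> < e" using \<open>e > 0\<close> K by (simp add: \<epsilon>_def)
    finally show ?thesis by (simp add: dist_real_def)
  qed
  have "d / K > 0" using \<open>d > 0\<close> K by simp
  then show "\<forall>\<^sub>F h in at_right 0. dist (?q h) (L v) < e"
    unfolding eventually_at_right_field using main by blast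
qed

lemma symmetric_second_derivative:
  fixes f :: "'a::real_normed_vector \<Rightarrow> 'b::euclidean_space"
  assumes "open W" "y \<in> W"
    and f: "\<And>x. x \<in> W \<Longrightarrow> (f has_derivative f' x) (at x)"
    and u: "((\<lambda>x. f' x u) has_derivative Lu) (at y)"
    and v: "((\<lambda>x. f' x v) has_derivative Lv) (at y)"
  shows "Lu v = Lv u"
proof (rule euclidean_eqI)
  fix b :: 'b assume "b \<in> Basis"
  define F where "F x = f x \<bullet> b" for x
  have F: "(F has_derivative (\<lambda>z. f' x z \<bullet> b)) (at x)" if "x \<in> W" for x
    unfolding F_def using f[OF that] by (auto intro!: derivative_eq_intros)
  have "((\<lambda>x. f' x u \<bullet> b) has_derivative (\<lambda>z. Lu z \<bullet> b)) (at y)"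
    "((\<lambda>x. f' x v \<bullet> b) has_derivative (\<lambda>z. Lv z \<bullet> b)) (at y)"
    using u v by (auto intro!: derivative_eq_intros)
  note * = second_difference_limit[OF assms(1,2) F this(1), of v]
    second_difference_limit[OF assms(1,2) F this(2), of u]
  have "(F (y + h *\<^sub>R u + h *\<^sub>R v) - F (y + h *\<^sub>R u) - F (y + h *\<^sub>R v) + F y)
      = (F (y + h *\<^sub>R v + h *\<^sub>R u) - F (y + h *\<^sub>R v) - F (y + h *\<^sub>R u) + F y)" for h
    by (simp add: add.commute add.left_commute)
  with *(1) have "((\<lambda>h. (F (y + h *\<^sub>R v + h *\<^sub>R u) - F (y + h *\<^sub>R v) - F (y + h *\<^sub>R u) + F y) / h\<^sup>2)
      \<longlongrightarrow> Lu v \<bullet> b) (at_right 0)" by simp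
  from tendsto_unique[OF _ this *(2)] show "Lu v \<bullet> b = Lv u \<bullet> b" by simp
qed

lemma Ck_onD:
  assumes "Ck_on (Suc 0) f W" "y \<in> W"
  shows "(f has_derivative frechet_derivative f (at y)) (at y)"
  using assms frechet_derivative_works by auto

lemma Ck_on2D:
  assumes "Ck_on (Suc (Suc 0)) f W" "y \<in> W"
  shows "(f has_derivative frechet_derivative f (at y)) (at y)"
    "((\<lambda>x. frechet_derivative f (at x) u) has_derivative
       frechet_derivative (\<lambda>x. frechet_derivative f (at x) u) (at y)) (at y)"
  using assms by (auto simp flip: frechet_derivative_works)

lemma Ck_on2_symmetric:
  fixes f :: "'a::euclidean_space \<Rightarrow> 'b::euclidean_space"
  assumes "Ck_on (Suc (Suc 0)) f W" "open W" "y \<in> W"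
  shows "frechet_derivative (\<lambda>x. frechet_derivative f (at x) u) (at y) v
       = frechet_derivative (\<lambda>x. frechet_derivative f (at x) v) (at y) u"
  by (rule symmetric_second_derivative[OF assms(2,3) Ck_on2D(1)[OF assms(1)]])
    (use Ck_on2D(2)[OF assms(1,3)] in auto)

section \<open>Partial derivatives of smooth families\<close>

lemma has_derivative_local:
  assumes "(g has_derivative g') (at x within T)" "open W" "x \<in> W" "x \<in> T"
    and "\<And>z. z \<in> T \<Longrightarrow> z \<in> W \<Longrightarrow> f z = g z"
  shows "(f has_derivative g') (at x within T)"
proof -
  obtain d where d: "d > 0" "ball x d \<subseteq> W" using assms(2,3) open_contains_ball by blast
  show ?thesis
    by (rule has_derivative_transform_within[OF assms(1) d(1) assms(4)])
      (use d(2) assms(5) in \<open>auto simp: dist_commute subset_iff\<close>)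
qed

text \<open>A function defined only on \<open>I \<times> C\<close> is studied through a differentiable extension \<open>g\<close> to an open set; the
  partial derivatives of the function are those of \<open>g\<close>, even at endpoints of \<open>I\<close> and at boundary points.\<close>

lemma slice_space:
  assumes g: "(g has_derivative g') (at (b, z))" and W: "open W" "(b, z) \<in> W" and z: "z \<in> C"
    and eq: "\<And>z'. z' \<in> C \<Longrightarrow> (b, z') \<in> W \<Longrightarrow> f z' = g (b, z')"
  shows "(f has_derivative (\<lambda>Z. g' (0, Z))) (at z within C)"
proof (rule has_derivative_local)
  have "((\<lambda>z. (b, z)) has_derivative (\<lambda>Z. (0, Z))) (at z within C)"
    by (auto intro!: derivative_eq_intros)
  from has_derivative_compose[OF this g]
  show "((\<lambda>z. g (b, z)) has_derivative (\<lambda>Z. g' (0, Z))) (at z within C)" .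
  show "open (Pair b -` W)" by (intro open_vimage W continuous_intros)
qed (use W z eq in auto)

lemma slice_time:
  fixes g :: "real \<times> 'a::real_normed_vector \<Rightarrow> 'b::real_normed_vector"
  assumes g: "(g has_derivative g') (at (b, z))" and W: "open W" "(b, z) \<in> W" and b: "b \<in> I"
    and eq: "\<And>b'. b' \<in> I \<Longrightarrow> (b', z) \<in> W \<Longrightarrow> f b' = g (b', z)"
  shows "(f has_vector_derivative g' (1, 0)) (at b within I)"
proof -
  have lin: "linear g'" using g by (rule has_derivative_linear)
  have "(f has_derivative (\<lambda>t. g' (t, 0))) (at b within I)"
  proof (rule has_derivative_local)
    have "((\<lambda>b. (b, z)) has_derivative (\<lambda>t. (t, 0))) (at b within I)"
      by (auto intro!: derivative_eq_intros)
    from has_derivative_compose[OF this g]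
    show "((\<lambda>b. g (b, z)) has_derivative (\<lambda>t. g' (t, 0))) (at b within I)" .
    show "open ((\<lambda>b. (b, z)) -` W)" by (intro open_vimage W continuous_intros)
  qed (use W b eq in auto)
  moreover have "(\<lambda>t. g' (t, 0)) = (\<lambda>t. t *\<^sub>R g' (1, 0))"
  proof
    fix t :: real
    have "(t, 0) = t *\<^sub>R (1, 0 :: 'a)" by simp
    then show "g' (t, 0) = t *\<^sub>R g' (1, 0)" by (simp only: linear_scale[OF lin])
  qed
  ultimately show ?thesis unfolding has_vector_derivative_def by (simp only:)
qed

lemma smooth_on_has_derivative:
  assumes "smooth_on S f" "x \<in> S"
  obtains f' where "(f has_derivative f') (at x within S)"
proof -
  obtain W g where W: "open W" "x \<in> W" "\<forall>k. Ck_on k g W" "\<forall>y\<in>S \<inter> W. f y = g y"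
    using assms unfolding smooth_on_def by blast
  have "(g has_derivative frechet_derivative g (at x)) (at x)" using Ck_onD W by blast
  then have "(f has_derivative frechet_derivative g (at x)) (at x within S)"
    by (intro has_derivative_local[OF has_derivative_at_withinI W(1,2) assms(2)]) (use W in auto)
  then show ?thesis by (rule that)
qed

lemma smooth_on_real_derivative:
  fixes f :: "real \<Rightarrow> real"
  assumes "smooth_on I f" "a \<in> I"
  shows "(f has_real_derivative vector_derivative f (at a within I)) (at a within I)"
proof -
  obtain f' where "(f has_derivative f') (at a within I)" using smooth_on_has_derivative[OF assms] .
  then show ?thesis
    by (auto simp: has_real_derivative_iff_has_vector_derivative differentiable_def
        simp flip: vector_derivative_works)
qed

lemma smooth_on_Times_extension:
  assumes "smooth_on (I \<times> C) (\<lambda>(a, x). f a x)" "y \<in> I \<times> C"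
  obtains W g where "open W" "y \<in> W" "\<And>k. Ck_on k g W"
    "\<And>a x. a \<in> I \<Longrightarrow> x \<in> C \<Longrightarrow> (a, x) \<in> W \<Longrightarrow> f a x = g (a, x)"
proof -
  obtain W g where W: "open W" "y \<in> W" "\<forall>k. Ck_on k g W"
    "\<forall>y\<in>(I \<times> C) \<inter> W. (\<lambda>(a, x). f a x) y = g y"
    using assms unfolding smooth_on_def by blast
  show ?thesis
  proof (rule that[OF W(1,2)])
    show "Ck_on k g W" for k using W(3) by blast
    show "f a x = g (a, x)" if "a \<in> I" "x \<in> C" "(a, x) \<in> W" for a x
      using bspec[OF W(4), of "(a, x)"] that by simp
  qed
qed

lemma smooth_on_slice:
  assumes "smooth_on (I \<times> C) (\<lambda>(a, x). f a x)" "a \<in> I" "x \<in> C"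
  shows "\<exists>L. (f a has_derivative L) (at x within C)"
proof -
  have "(a, x) \<in> I \<times> C" using assms by simp
  from smooth_on_Times_extension[OF assms(1) this]
  obtain W g where W: "open W" "(a, x) \<in> W" "\<And>k. Ck_on k g W"
    "\<And>a x. a \<in> I \<Longrightarrow> x \<in> C \<Longrightarrow> (a, x) \<in> W \<Longrightarrow> f a x = g (a, x)" by blast
  from slice_space[OF Ck_onD[OF W(3,2)] W(1,2) assms(3) W(4)[OF assms(2)]] show ?thesis by blast
qed

section \<open>The ambient bilinear form\<close>

lemma bounded_bilinear_metric: "bounded_bilinear (metric \<kappa> :: real \<times> 'e::euclidean_space \<Rightarrow> _)"
proof -
  have "bounded_linear (\<lambda>u::real \<times> 'e. (\<kappa> * fst u, snd u))"
    by (intro bounded_linear_Pair bounded_linear_const_mult bounded_linear_fst bounded_linear_snd)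
  moreover have "metric \<kappa> = (\<lambda>u v::real \<times> 'e. (\<kappa> * fst u, snd u) \<bullet> v)"
    by (intro ext) (simp add: metric_def inner_prod_def mult.assoc)
  ultimately show ?thesis using bounded_bilinear.comp1[OF bounded_bilinear_inner] by metis
qed

lemmas metric_add_left = bounded_bilinear.add_left[OF bounded_bilinear_metric]
  and metric_add_right = bounded_bilinear.add_right[OF bounded_bilinear_metric]
  and metric_diff_left = bounded_bilinear.diff_left[OF bounded_bilinear_metric]
  and metric_diff_right = bounded_bilinear.diff_right[OF bounded_bilinear_metric]
  and metric_scaleR_left = bounded_bilinear.scaleR_left[OF bounded_bilinear_metric, unfolded real_scaleR_def]
  and metric_scaleR_right = bounded_bilinear.scaleR_right[OF bounded_bilinear_metric, unfolded real_scaleR_def]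
  and metric_zero_left = bounded_bilinear.zero_left[OF bounded_bilinear_metric]
  and metric_zero_right = bounded_bilinear.zero_right[OF bounded_bilinear_metric]
  and has_derivative_metric = bounded_bilinear.FDERIV[OF bounded_bilinear_metric]
  and has_vector_derivative_metric = bounded_bilinear.has_vector_derivative[OF bounded_bilinear_metric]

lemmas metric_simps = metric_add_left metric_add_right metric_diff_left metric_diff_right
  metric_scaleR_left metric_scaleR_right

lemma metric_commute: "metric \<kappa> u v = metric \<kappa> v u"
  by (simp add: metric_def inner_commute mult.commute)

lemma tangent_space_metric:
  assumes "\<kappa> \<in> {-1, 1}"
  shows "v \<in> tangent_space \<kappa> q \<longleftrightarrow> metric \<kappa> q v = 0"
  using assms by (auto simp: tangent_space_def metric_def)

lemma tangent_space_0: "q \<in> space_form 0 \<Longrightarrow> v \<in> tangent_space 0 q \<longleftrightarrow> fst v = 0"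
  by (auto simp: tangent_space_def space_form_0)

text \<open>For \<open>\<kappa> = 0\<close> the base point is not normal to the tangent space; the factor \<open>\<kappa>\<close> makes the statement
  uniform, and the position vector only ever enters with this factor.\<close>

lemma curvature_metric_tangent:
  assumes "\<kappa> \<in> {-1, 0, 1}" "v \<in> tangent_space \<kappa> q"
  shows "\<kappa> * metric \<kappa> q v = 0"
  using assms by (auto simp: tangent_space_def metric_def)

lemma curvature_metric_self:
  assumes "\<kappa> \<in> {-1, 0, 1}" "q \<in> space_form \<kappa>"
  shows "\<kappa> * metric \<kappa> q q = \<kappa> * \<kappa>"
  using assms metric_self[of \<kappa> q] by auto

lemma space_formI:
  assumes "\<kappa> \<in> {-1, 1}" "metric \<kappa> q q = \<kappa>" "\<kappa> = -1 \<Longrightarrow> 0 < fst q"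
  shows "q \<in> space_form \<kappa>"
  using assms by (auto simp: space_form_def metric_def power2_eq_square dot_square_norm)

text \<open>A Euclidean description of the tangent space, which for \<open>\<kappa> = 0\<close> also holds although the form itself is degenerate.\<close>

lemma tangent_space_hyperplane:
  "tangent_space \<kappa> q = {v. (fst q, \<kappa> *\<^sub>R snd q) \<bullet> v = 0}"
  by (simp add: tangent_space_def inner_prod_def)

lemma subspace_tangent_space: "subspace (tangent_space \<kappa> q)"
  unfolding tangent_space_hyperplane by (rule subspace_hyperplane)

lemma metric_nonneg:
  assumes "\<kappa> \<in> {-1, 0, 1}" "q \<in> space_form \<kappa>" "v \<in> tangent_space \<kappa> q"
  shows "0 \<le> metric \<kappa> v v"
  using metric_pos[OF assms] by (cases "v = 0") (auto simp: metric_zero_left)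

text \<open>The form is indefinite for \<open>\<kappa> = -1\<close> and degenerate for \<open>\<kappa> = 0\<close>, but definite on each tangent space.\<close>

lemma metric_Cauchy_Schwarz:
  assumes "\<kappa> \<in> {-1, 0, 1}" "q \<in> space_form \<kappa>" "u \<in> tangent_space \<kappa> q" "v \<in> tangent_space \<kappa> q"
  shows "(metric \<kappa> u v)\<^sup>2 \<le> metric \<kappa> u u * metric \<kappa> v v"
proof (cases "v = 0")
  case False
  define b where "b = metric \<kappa> v v"
  have b: "b > 0" unfolding b_def using metric_pos[OF assms(1,2,4) False] .
  define z where "z = b *\<^sub>R u - metric \<kappa> u v *\<^sub>R v"
  have "z \<in> tangent_space \<kappa> q"
    unfolding z_def by (intro subspace_diff subspace_scale subspace_tangent_space assms)
  then have "0 \<le> metric \<kappa> z z" by (rule metric_nonneg[OF assms(1,2)])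
  also have "metric \<kappa> z z = b * (metric \<kappa> u u * b - (metric \<kappa> u v)\<^sup>2)"
    unfolding z_def using b_def metric_commute[of \<kappa> v u]
    by (simp add: metric_simps algebra_simps power2_eq_square)
  finally show ?thesis using b by (simp add: zero_le_mult_iff b_def[symmetric])
qed (simp add: metric_zero_right)

lemma space_form_derivative_tangent:
  assumes f: "(f has_derivative f') (at y)" and v: "accumulates_along S y v"
    and Q: "\<And>z. z \<in> S \<Longrightarrow> f z \<in> space_form \<kappa>" and y: "y \<in> S"
  shows "f' v \<in> tangent_space \<kappa> (f y)"
proof -
  have "((\<lambda>z. (fst (f z))\<^sup>2 + \<kappa> * (snd (f z) \<bullet> snd (f z))) has_derivative
      (\<lambda>v. 2 * (fst (f y) * fst (f' v) + \<kappa> * (snd (f y) \<bullet> snd (f' v))))) (at y within S)"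
    using has_derivative_at_withinI[OF f]
    by (auto intro!: derivative_eq_intros simp: inner_commute algebra_simps)
  from derivative_eq_along[OF this has_derivative_const[of 1] v] Q y
  have "2 * (fst (f y) * fst (f' v) + \<kappa> * (snd (f y) \<bullet> snd (f' v))) = 0"
    by (simp add: space_form_def dot_square_norm)
  then show ?thesis by (simp add: tangent_space_def)
qed

section \<open>Trigonometry of the space forms\<close>

text \<open>The solutions of \<open>f'' = - \<kappa> f\<close> with initial data \<open>(0, 1)\<close> and \<open>(1, 0)\<close>.\<close>

definition sn :: "real \<Rightarrow> real \<Rightarrow> real" where
  "sn \<kappa> t = (if \<kappa> = 1 then sin t else if \<kappa> = 0 then t else sinh t)"

definition cs :: "real \<Rightarrow> real \<Rightarrow> real" where
  "cs \<kappa> t = (if \<kappa> = 1 then cos t else if \<kappa> = 0 then 1 else cosh t)"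

lemma sn_0 [simp]: "sn \<kappa> 0 = 0" and cs_0 [simp]: "cs \<kappa> 0 = 1"
  by (simp_all add: sn_def cs_def)

lemma ct_eq: "ct \<kappa> t = cs \<kappa> t / sn \<kappa> t"
  by (simp add: ct_def cs_def sn_def cot_def)

lemma sn_has_derivative:
  assumes "\<kappa> \<in> {-1, 0, 1}"
  shows "(sn \<kappa> has_real_derivative cs \<kappa> t) (at t within S)"
  using assms unfolding sn_def[abs_def] cs_def by (auto intro!: derivative_eq_intros)

lemma cs_has_derivative:
  assumes "\<kappa> \<in> {-1, 0, 1}"
  shows "(cs \<kappa> has_real_derivative - \<kappa> * sn \<kappa> t) (at t within S)"
  using assms unfolding cs_def[abs_def] sn_def by (auto intro!: derivative_eq_intros)

lemma cs_sn_squared: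
  assumes "\<kappa> \<in> {-1, 0, 1}"
  shows "(cs \<kappa> t)\<^sup>2 + \<kappa> * (sn \<kappa> t)\<^sup>2 = 1"
  using assms by (auto simp: cs_def sn_def cosh_square_eq)

lemma sn_double:
  assumes "\<kappa> \<in> {-1, 0, 1}"
  shows "sn \<kappa> t = 2 * sn \<kappa> (t / 2) * cs \<kappa> (t / 2)"
proof -
  have "sin t = 2 * sin (t / 2) * cos (t / 2)" "sinh t = 2 * sinh (t / 2) * cosh (t / 2)"
    using sin_double[of "t / 2"] sinh_double[of "t / 2"] by (simp_all only: mult_2 field_sum_of_halves)
  then show ?thesis using assms by (auto simp: cs_def sn_def)
qed

lemma sn_nonneg: "0 \<le> s \<Longrightarrow> (\<kappa> = 1 \<Longrightarrow> s \<le> pi) \<Longrightarrow> 0 \<le> sn \<kappa> s"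
  by (auto simp: sn_def sin_ge_zero)

lemma sn_pos: "0 < s \<Longrightarrow> (\<kappa> = 1 \<Longrightarrow> s < pi) \<Longrightarrow> 0 < sn \<kappa> s"
  by (auto simp: sn_def sin_gt_zero)

text \<open>For \<open>\<kappa> = \<plusminus>1\<close>, \<open>cs(\<rho>)\<close> is a multiple of \<open>\<langle>p, q\<rangle>\<close>, but this says nothing for \<open>\<kappa> = 0\<close>. The squared chord determines
  the distance for all three curvatures.\<close>

definition sq_chord :: "real \<Rightarrow> real \<Rightarrow> real" where
  "sq_chord \<kappa> s = 4 * (sn \<kappa> (s / 2))\<^sup>2"

lemma sq_chord_has_derivative:
  assumes "\<kappa> \<in> {-1, 0, 1}"
  shows "(sq_chord \<kappa> has_real_derivative 2 * sn \<kappa> s) (at s within S)"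
  unfolding sq_chord_def[abs_def] sn_double[OF assms, of s]
  by (auto intro!: derivative_eq_intros DERIV_chain2[OF sn_has_derivative[OF assms]])

lemma sq_chord_cs:
  assumes "\<kappa> \<in> {-1, 0, 1}"
  shows "\<kappa> * sq_chord \<kappa> s = 2 * (1 - cs \<kappa> s)"
proof -
  have "cos s = 1 - 2 * (sin (s / 2))\<^sup>2" "cosh s = (cosh (s / 2))\<^sup>2 + (sinh (s / 2))\<^sup>2"
    using cos_double_sin[of "s / 2"] cosh_double[of "s / 2"] by (simp_all only: mult_2 field_sum_of_halves)
  then show ?thesis using assms by (elim insertE) (simp_all add: sq_chord_def sn_def cs_def cosh_square_eq)
qed

lemma sq_chord_0 [simp]: "sq_chord \<kappa> 0 = 0"
  by (simp add: sq_chord_def sn_def)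

text \<open>The inverse of the squared chord; explicit so that its derivative is available.\<close>

definition radius :: "real \<Rightarrow> real \<Rightarrow> real" where
  "radius \<kappa> w = (if \<kappa> = 1 then arccos (1 - w / 2) else if \<kappa> = 0 then sqrt w else arcosh (1 + w / 2))"

lemma radius_sq_chord:
  assumes "\<kappa> \<in> {-1, 0, 1}" "0 \<le> s" "\<kappa> = 1 \<Longrightarrow> s \<le> pi"
  shows "radius \<kappa> (sq_chord \<kappa> s) = s"
proof -
  have *: "1 - \<kappa> * sq_chord \<kappa> s / 2 = cs \<kappa> s"
    using sq_chord_cs[OF assms(1), of s] by (simp add: field_simps)
  show ?thesis
  proof (cases "\<kappa> = 0")
    case True
    then show ?thesis using assms by (simp add: radius_def sq_chord_def sn_def power_divide)
  next
    case False
    then have "\<kappa> = 1 \<or> \<kappa> = -1" using assms by auto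
    then show ?thesis
    proof
      assume "\<kappa> = 1"
      then show ?thesis using * assms by (simp add: radius_def cs_def arccos_cos)
    next
      assume "\<kappa> = -1"
      then show ?thesis using * assms by (simp add: radius_def cs_def arcosh_cosh_real)
    qed
  qed
qed

lemma radius_has_derivative:
  assumes "\<kappa> \<in> {-1, 0, 1}" "0 < s" "\<kappa> = 1 \<Longrightarrow> s < pi"
  shows "(radius \<kappa> has_real_derivative 1 / (2 * sn \<kappa> s)) (at (sq_chord \<kappa> s))"
proof -
  have *: "1 - \<kappa> * sq_chord \<kappa> s / 2 = cs \<kappa> s"
    using sq_chord_cs[OF assms(1), of s] by (simp add: field_simps)
  consider "\<kappa> = 0" | "\<kappa> = 1" | "\<kappa> = -1" using assms(1) by auto
  then show ?thesis
  proof cases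
    case 1
    then have "sq_chord \<kappa> s = s\<^sup>2" by (simp add: sq_chord_def sn_def power_divide)
    then show ?thesis using 1 assms unfolding radius_def[abs_def] sn_def
      by (auto intro!: derivative_eq_intros simp: field_simps)
  next
    case 2
    have "- 1 < cos s" "cos s < 1"
      using assms 2 cos_monotone_0_pi[of s pi] cos_monotone_0_pi[of 0 s] by auto
    moreover have "sqrt (1 - (cos s)\<^sup>2) = sin s"
      using assms 2 by (simp add: sin_squared_eq[symmetric] sin_ge_zero)
    moreover have "1 - sq_chord \<kappa> s / 2 = cos s" using 2 * by (simp add: cs_def)
    ultimately have "(arccos has_real_derivative inverse (- sin s)) (at (1 - sq_chord \<kappa> s / 2))"
      using DERIV_arccos[of "cos s"] by simp
    then have "((\<lambda>w. arccos (1 - w / 2)) has_real_derivative inverse (- sin s) * (-1/2)) (at (sq_chord \<kappa> s))"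
      by (rule DERIV_chain2) (auto intro!: derivative_eq_intros)
    moreover have "inverse (- sin s) * (-1/2) = 1 / (2 * sin s)" by (simp add: inverse_eq_divide)
    ultimately have "((\<lambda>w. arccos (1 - w / 2)) has_real_derivative 1 / (2 * sin s)) (at (sq_chord \<kappa> s))"
      by (simp only:)
    then show ?thesis using 2 unfolding radius_def[abs_def] sn_def by simp
  next
    case 3
    have ch: "1 < cosh s" using assms cosh_real_strict_mono[of 0 s] by simp
    have sh: "sqrt ((cosh s)\<^sup>2 - 1) = sinh s" using assms by (simp add: cosh_square_eq)
    have e: "1 + sq_chord \<kappa> s / 2 = cosh s" using 3 * by (simp add: cs_def)
    have "(arcosh has_real_derivative 1 / sinh s) (at (1 + sq_chord \<kappa> s / 2))"
      using arcosh_real_has_field_derivative[OF ch, of UNIV] unfolding e sh .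
    then have "((\<lambda>w. arcosh (1 + w / 2)) has_real_derivative (1 / sinh s) * (1/2)) (at (sq_chord \<kappa> s))"
      by (rule DERIV_chain2) (auto intro!: derivative_eq_intros)
    then show ?thesis using 3 unfolding radius_def[abs_def] sn_def by (simp add: mult.commute)
  qed
qed

section \<open>Distance and its gradient\<close>

lemma metric_chord:
  assumes "\<kappa> \<in> {-1, 1}" "p \<in> space_form \<kappa>" "q \<in> space_form \<kappa>"
  shows "metric \<kappa> (q - p) (q - p) = 2 * \<kappa> - 2 * metric \<kappa> p q"
  using metric_self[OF assms(1,2)] metric_self[OF assms(1,3)] metric_commute[of \<kappa> p q]
  by (simp add: metric_simps)

lemma exists_radius:
  assumes \<kappa>: "\<kappa> \<in> {-1, 0, 1}" and p: "p \<in> space_form \<kappa>" and q: "q \<in> space_form \<kappa>"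
  obtains s where "0 \<le> s" "\<kappa> = 1 \<Longrightarrow> s \<le> pi" "metric \<kappa> (q - p) (q - p) = sq_chord \<kappa> s"
proof -
  consider "\<kappa> = 0" | "\<kappa> = 1" | "\<kappa> = -1" using \<kappa> by auto
  then show ?thesis
  proof cases
    case 1
    have "metric \<kappa> (q - p) (q - p) = sq_chord \<kappa> (norm (snd (q - p)))"
      using 1 unfolding metric_def sq_chord_def sn_def by (simp add: power_divide dot_square_norm)
    then show ?thesis using 1 by (intro that) auto
  next
    case 2
    have pq: "metric \<kappa> p q = p \<bullet> q" using 2 by (simp add: metric_def inner_prod_def)
    have "norm p = 1" "norm q = 1" using p q 2 by (auto simp: space_form_1)
    then have "\<bar>p \<bullet> q\<bar> \<le> 1" using Cauchy_Schwarz_ineq2[of p q] by simp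
    then have pq1: "-1 \<le> p \<bullet> q" "p \<bullet> q \<le> 1" by auto
    define s where "s = arccos (p \<bullet> q)"
    have s: "cos s = p \<bullet> q" "0 \<le> s" "s \<le> pi"
      unfolding s_def using pq1 by (simp_all only: cos_arccos arccos_lbound arccos_ubound)
    have "metric \<kappa> (q - p) (q - p) = 2 - 2 * (p \<bullet> q)"
      using metric_chord[of \<kappa> p q] 2 pq p q by simp
    also have "\<dots> = sq_chord \<kappa> s"
      using sq_chord_cs[OF \<kappa>, of s] 2 s by (simp add: cs_def)
    finally show ?thesis using s that by blast
  next
    case 3
    obtain a x b y where pq: "p = (a, x)" "q = (b, y)" by (metis surj_pair)
    have a: "a\<^sup>2 = 1 + (norm x)\<^sup>2" "a > 0" and b: "b\<^sup>2 = 1 + (norm y)\<^sup>2" "b > 0"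
      using p q 3 pq by (auto simp: space_form_def)
    have "(a * b)\<^sup>2 = (1 + (norm x)\<^sup>2) * (1 + (norm y)\<^sup>2)" by (simp add: power_mult_distrib a b)
    also have "\<dots> = (1 + norm x * norm y)\<^sup>2 + (norm x - norm y)\<^sup>2"
      by (simp add: power2_eq_square algebra_simps)
    finally have "(1 + norm x * norm y)\<^sup>2 \<le> (a * b)\<^sup>2" by simp
    then have "1 + norm x * norm y \<le> a * b"
      by (rule power2_le_imp_le) (use a(2) b(2) in simp)
    then have u: "1 \<le> - metric \<kappa> p q" using 3 pq norm_cauchy_schwarz[of x y] by (simp add: metric_def)
    define s where "s = arcosh (- metric \<kappa> p q)"
    have s: "cosh s = - metric \<kappa> p q" "0 \<le> s"
      unfolding s_def using u by (rule cosh_arcosh_real, rule arcosh_nonneg_real)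
    have "metric \<kappa> (q - p) (q - p) = - 2 - 2 * metric \<kappa> p q"
      using metric_chord[of \<kappa> p q] 3 p q by simp
    also have "\<dots> = sq_chord \<kappa> s"
      using sq_chord_cs[OF \<kappa>, of s] 3 s by (simp add: cs_def)
    finally show ?thesis using s 3 by (intro that) auto
  qed
qed

text \<open>The vector \<open>cs(s) q - p\<close> is \<open>sn(s)\<close> times the unit vector at \<open>q\<close> pointing away from \<open>p\<close>. Orthogonality to \<open>q\<close> is
  the relation between \<open>\<langle>p, q\<rangle>\<close> and the chord.\<close>

lemma radial_vector:
  assumes \<kappa>: "\<kappa> \<in> {-1, 0, 1}" and p: "p \<in> space_form \<kappa>" and q: "q \<in> space_form \<kappa>"
    and s: "metric \<kappa> (q - p) (q - p) = sq_chord \<kappa> s"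
  shows "cs \<kappa> s *\<^sub>R q - p \<in> tangent_space \<kappa> q"
    and "metric \<kappa> (cs \<kappa> s *\<^sub>R q - p) (cs \<kappa> s *\<^sub>R q - p) = (sn \<kappa> s)\<^sup>2"
proof -
  have "cs \<kappa> s *\<^sub>R q - p \<in> tangent_space \<kappa> q \<and>
     metric \<kappa> (cs \<kappa> s *\<^sub>R q - p) (cs \<kappa> s *\<^sub>R q - p) = (sn \<kappa> s)\<^sup>2"
  proof (cases "\<kappa> = 0")
    case True
    have "fst p = 1" "fst q = 1" using p q True by (auto simp: space_form_0)
    then show ?thesis using s tangent_space_0[of q] q True
      by (auto simp: cs_def sn_def sq_chord_def power_divide)
  next
    case False
    then have k: "\<kappa> \<in> {-1, 1}" using \<kappa> by auto
    have kk: "\<kappa> * \<kappa> = 1" using k by auto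
    have pq: "metric \<kappa> p q = \<kappa> * cs \<kappa> s"
    proof -
      have "\<kappa> * (2 * \<kappa> - 2 * metric \<kappa> p q) = 2 * (1 - cs \<kappa> s)"
        using metric_chord[OF k p q] s sq_chord_cs[OF \<kappa>, of s] by (simp only:)
      then show ?thesis using k by auto
    qed
    have qq: "metric \<kappa> q q = \<kappa>" "metric \<kappa> p p = \<kappa>" using metric_self[OF k] p q by blast+
    have "metric \<kappa> q (cs \<kappa> s *\<^sub>R q - p) = 0"
      using pq qq metric_commute[of \<kappa> q p] by (simp add: metric_simps)
    moreover have "metric \<kappa> (cs \<kappa> s *\<^sub>R q - p) (cs \<kappa> s *\<^sub>R q - p) = \<kappa> * (1 - (cs \<kappa> s)\<^sup>2)"
      using pq qq metric_commute[of \<kappa> q p] by (simp add: metric_simps algebra_simps power2_eq_square)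
    moreover have "1 - (cs \<kappa> s)\<^sup>2 = \<kappa> * (sn \<kappa> s)\<^sup>2" using cs_sn_squared[OF \<kappa>, of s] by simp
    ultimately show ?thesis using kk by (simp add: tangent_space_metric[OF k] flip: mult.assoc)
  qed
  then show "cs \<kappa> s *\<^sub>R q - p \<in> tangent_space \<kappa> q"
    and "metric \<kappa> (cs \<kappa> s *\<^sub>R q - p) (cs \<kappa> s *\<^sub>R q - p) = (sn \<kappa> s)\<^sup>2" by auto
qed

definition geodesic :: "real \<Rightarrow> real \<times> 'e::euclidean_space \<Rightarrow> real \<times> 'e \<Rightarrow> real \<Rightarrow> real \<times> 'e" where
  "geodesic \<kappa> p e t = cs \<kappa> t *\<^sub>R p + sn \<kappa> t *\<^sub>R e"

text \<open>For \<open>\<kappa> = -1\<close> the curve could lie on the wrong sheet of the hyperboloid; a unit tangent vector at \<open>p\<close> has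
  a time component smaller than that of \<open>p\<close>, which excludes this.\<close>

lemma geodesic_in_space_form:
  assumes \<kappa>: "\<kappa> \<in> {-1, 0, 1}" and p: "p \<in> space_form \<kappa>" and e: "e \<in> tangent_space \<kappa> p" "metric \<kappa> e e = 1"
  shows "geodesic \<kappa> p e t \<in> space_form \<kappa>"
proof (cases "\<kappa> = 0")
  case True
  then show ?thesis using p e tangent_space_0[of p e]
    by (auto simp: space_form_0 geodesic_def cs_def mem_Times_iff)
next
  case False
  then have k: "\<kappa> \<in> {-1, 1}" using \<kappa> by auto
  show ?thesis
  proof (rule space_formI[OF k])
    have "metric \<kappa> p e = 0" using e tangent_space_metric[OF k] by blast
    then have "metric \<kappa> (geodesic \<kappa> p e t) (geodesic \<kappa> p e t) = (cs \<kappa> t)\<^sup>2 * \<kappa> + (sn \<kappa> t)\<^sup>2"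
      using metric_self[OF k p] e metric_commute[of \<kappa> p e]
      by (simp add: geodesic_def metric_simps power2_eq_square algebra_simps)
    also have "\<dots> = \<kappa>" using cs_sn_squared[OF \<kappa>, of t] k by (auto simp: algebra_simps)
    finally show "metric \<kappa> (geodesic \<kappa> p e t) (geodesic \<kappa> p e t) = \<kappa>" .
  next
    assume m: "\<kappa> = -1"
    obtain a x b y where pe: "p = (a, x)" "e = (b, y)" by (metis surj_pair)
    have a: "a\<^sup>2 = 1 + x \<bullet> x" "a > 0" and ab: "a * b = x \<bullet> y" and yy: "y \<bullet> y = b\<^sup>2 + 1"
      using p e m pe
      by (auto simp: space_form_def tangent_space_def metric_def dot_square_norm power2_eq_square)
    have "(a * b)\<^sup>2 \<le> (x \<bullet> x) * (y \<bullet> y)" unfolding ab by (rule Cauchy_Schwarz_ineq)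
    also have "\<dots> = (a\<^sup>2 - 1) * (b\<^sup>2 + 1)" using a yy by simp
    finally have "b\<^sup>2 < a\<^sup>2" by (simp add: algebra_simps power_mult_distrib)
    then have "\<bar>b\<bar>\<^sup>2 < a\<^sup>2" by simp
    then have "\<bar>b\<bar> < a" by (rule power2_less_imp_less) (use a(2) in simp)
    moreover have "\<bar>sinh t\<bar> < cosh t"
    proof (rule power2_less_imp_less)
      show "\<bar>sinh t\<bar>\<^sup>2 < (cosh t)\<^sup>2" by (simp add: cosh_square_eq)
    qed simp
    ultimately have "\<bar>b\<bar> * \<bar>sinh t\<bar> < a * cosh t"
      by (intro mult_strict_mono') auto
    moreover have "- (sinh t * b) \<le> \<bar>b\<bar> * \<bar>sinh t\<bar>"
      by (metis abs_ge_minus_self abs_mult mult.commute)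
    ultimately show "0 < fst (geodesic \<kappa> p e t)"
      using m pe by (simp add: geodesic_def cs_def sn_def mult.commute)
  qed
qed

lemma geodesic_has_derivative:
  assumes "\<kappa> \<in> {-1, 0, 1}"
  shows "(geodesic \<kappa> p e has_vector_derivative (- \<kappa> * sn \<kappa> t) *\<^sub>R p + cs \<kappa> t *\<^sub>R e) (at t within S)"
  unfolding geodesic_def[abs_def]
  using sn_has_derivative[OF assms, of t S] cs_has_derivative[OF assms, of t S]
  by (auto intro!: derivative_eq_intros)

lemma exists_unit_tangent:
  fixes p :: "real \<times> 'e::euclidean_space"
  assumes "\<kappa> \<in> {-1, 0, 1}" "p \<in> space_form \<kappa>"
  obtains e where "e \<in> tangent_space \<kappa> p" "metric \<kappa> e e = 1"
proof -
  have "2 \<le> DIM(real \<times> 'e)" using DIM_positive[where 'a='e] by simp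
  then obtain v where v: "v \<noteq> 0" "orthogonal (fst p, \<kappa> *\<^sub>R snd p) v"
    by (rule orthogonal_to_vector_exists)
  then have vT: "v \<in> tangent_space \<kappa> p" by (simp add: tangent_space_hyperplane orthogonal_def)
  have pos: "0 < metric \<kappa> v v" using metric_pos[OF assms vT v(1)] .
  show ?thesis
  proof (rule that)
    show "(1 / sqrt (metric \<kappa> v v)) *\<^sub>R v \<in> tangent_space \<kappa> p"
      by (rule subspace_scale[OF subspace_tangent_space vT])
    show "metric \<kappa> ((1 / sqrt (metric \<kappa> v v)) *\<^sub>R v) ((1 / sqrt (metric \<kappa> v v)) *\<^sub>R v) = 1"
      using pos by (simp add: metric_simps)
  qed
qed

text \<open>If \<open>sn(s) = 0\<close>, that is for \<open>q = p\<close> or antipodal \<open>q\<close>, any unit direction serves; otherwise the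
  direction is a multiple of the radial vector at \<open>p\<close>.\<close>

lemma exists_geodesic:
  fixes p q :: "real \<times> 'e::euclidean_space"
  assumes \<kappa>: "\<kappa> \<in> {-1, 0, 1}" and p: "p \<in> space_form \<kappa>" and q: "q \<in> space_form \<kappa>"
    and s: "metric \<kappa> (q - p) (q - p) = sq_chord \<kappa> s"
  obtains e where "e \<in> tangent_space \<kappa> p" "metric \<kappa> e e = 1" "geodesic \<kappa> p e s = q"
proof -
  have "metric \<kappa> (p - q) (p - q) = sq_chord \<kappa> s"
    using s by (simp add: metric_simps algebra_simps)
  note rv = radial_vector[OF \<kappa> q p this]
  show ?thesis
  proof (cases "sn \<kappa> s = 0")
    case True
    with rv metric_pos[OF \<kappa> p rv(1)] have "cs \<kappa> s *\<^sub>R p = q" by force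
    moreover obtain e where "e \<in> tangent_space \<kappa> p" "metric \<kappa> e e = 1"
      using exists_unit_tangent[OF \<kappa> p] .
    ultimately show ?thesis using True by (intro that) (auto simp: geodesic_def)
  next
    case False
    define e where "e = (- 1 / sn \<kappa> s) *\<^sub>R (cs \<kappa> s *\<^sub>R p - q)"
    show ?thesis
    proof (rule that)
      show "e \<in> tangent_space \<kappa> p"
        unfolding e_def by (rule subspace_scale[OF subspace_tangent_space rv(1)])
      show "metric \<kappa> e e = 1"
        unfolding e_def metric_scaleR_left metric_scaleR_right rv(2)
        using False by (simp add: power2_eq_square)
      show "geodesic \<kappa> p e s = q"
        unfolding e_def geodesic_def using False by (simp add: algebra_simps)
    qed
  qed
qed

lemma geodesic_path:
  fixes p q :: "real \<times> 'e::euclidean_space"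
  assumes \<kappa>: "\<kappa> \<in> {-1, 0, 1}" and p: "p \<in> space_form \<kappa>"
    and e: "e \<in> tangent_space \<kappa> p" "metric \<kappa> e e = 1" and "0 \<le> s"
  defines "c \<equiv> \<lambda>t. geodesic \<kappa> p e (s * t)"
  shows "c \<in> curves_between \<kappa> p (geodesic \<kappa> p e s)" "integral {0..1} (speed \<kappa> c) = s"
proof -
  define c' where "c' t = s *\<^sub>R ((- \<kappa> * sn \<kappa> (s * t)) *\<^sub>R p + cs \<kappa> (s * t) *\<^sub>R e)" for t
  have d: "(c has_vector_derivative c' t) (at t)" for t
  proof -
    have "((\<lambda>t. s * t) has_vector_derivative s) (at t)"
      by (auto intro!: derivative_eq_intros)
    from vector_diff_chain_at[OF this geodesic_has_derivative[OF \<kappa>, of p e]]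
    show ?thesis unfolding c_def c'_def comp_def .
  qed
  have C1: "c C1_differentiable_on {0..1}"
  proof -
    have "continuous_on {0..1} c'"
      unfolding c'_def[abs_def] sn_def[abs_def] cs_def[abs_def]
      by (cases "\<kappa> = 1"; cases "\<kappa> = 0") (auto intro!: continuous_intros)
    then show ?thesis unfolding C1_differentiable_on_def using d by blast
  qed
  have sp: "speed \<kappa> c t = s" for t
  proof -
    have z: "\<kappa> * metric \<kappa> p e = 0" "\<kappa> * metric \<kappa> e p = 0" "\<kappa> * metric \<kappa> p p = \<kappa> * \<kappa>"
      using curvature_metric_tangent[OF \<kappa> e(1)] metric_commute[of \<kappa> e p]
        curvature_metric_self[OF \<kappa> p] by auto
    have M: "metric \<kappa> (c' t) (c' t) = s\<^sup>2 * (sn \<kappa> (s * t))\<^sup>2 * \<kappa> * (\<kappa> * metric \<kappa> p p)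
        - s\<^sup>2 * sn \<kappa> (s * t) * cs \<kappa> (s * t) * (\<kappa> * metric \<kappa> p e)
        - s\<^sup>2 * sn \<kappa> (s * t) * cs \<kappa> (s * t) * (\<kappa> * metric \<kappa> e p)
        + s\<^sup>2 * (cs \<kappa> (s * t))\<^sup>2 * metric \<kappa> e e"
      unfolding c'_def by (simp add: metric_simps algebra_simps power2_eq_square)
    have "metric \<kappa> (c' t) (c' t) = s\<^sup>2 * ((sn \<kappa> (s * t))\<^sup>2 * (\<kappa> * (\<kappa> * \<kappa>)) + (cs \<kappa> (s * t))\<^sup>2)"
      unfolding M z e(2) by (simp add: algebra_simps)
    also have "\<kappa> * (\<kappa> * \<kappa>) = \<kappa>" using \<kappa> by auto
    also have "(sn \<kappa> (s * t))\<^sup>2 * \<kappa> + (cs \<kappa> (s * t))\<^sup>2 = 1"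
      using cs_sn_squared[OF \<kappa>, of "s * t"] by (simp add: mult.commute)
    finally show ?thesis
      unfolding speed_def Let_def vector_derivative_at[OF d] using \<open>0 \<le> s\<close> by simp
  qed
  have sp': "speed \<kappa> c = (\<lambda>t. s)" using sp by auto
  show "integral {0..1} (speed \<kappa> c) = s" unfolding sp' by simp
  have "valid_path c" unfolding valid_path_def by (rule C1_differentiable_imp_piecewise[OF C1])
  moreover have "path_image c \<subseteq> space_form \<kappa>"
    unfolding path_image_def c_def using geodesic_in_space_form[OF \<kappa> p e] by auto
  moreover have "pathstart c = p" "pathfinish c = geodesic \<kappa> p e s"
    by (simp_all add: pathstart_def pathfinish_def c_def geodesic_def)
  moreover have "speed \<kappa> c integrable_on {0..1}" unfolding sp' by (rule integrable_const_ivl)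
  ultimately show "c \<in> curves_between \<kappa> p (geodesic \<kappa> p e s)"
    unfolding curves_between_def by blast
qed

text \<open>By the Cauchy-Schwarz inequality the squared chord changes at rate at most \<open>2 sn(s)\<close> times the speed.
  So if \<open>h' \<le> 1 / (2 sn(s))\<close> where the squared chord is that of \<open>s\<close>, then \<open>h\<close> of the squared chord
  grows by at most the length. The ideal choice \<open>h = radius\<close> is not differentiable at the
  centre and at its antipode, and a curve may pass through these infinitely often; hence \<open>h\<close> is left open.\<close>

lemma length_ge_calibration:
  fixes p q :: "real \<times> 'e::euclidean_space"
  assumes \<kappa>: "\<kappa> \<in> {-1, 0, 1}" and c: "c \<in> curves_between \<kappa> p q" and p: "p \<in> space_form \<kappa>"
    and h: "\<And>s. 0 \<le> s \<Longrightarrow> (\<kappa> = 1 \<Longrightarrow> s \<le> pi) \<Longrightarrow>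
       (h has_real_derivative h' s) (at (sq_chord \<kappa> s)) \<and> 0 \<le> h' s \<and> h' s * (2 * sn \<kappa> s) \<le> 1"
  shows "h (metric \<kappa> (q - p) (q - p)) - h 0 \<le> integral {0..1} (speed \<kappa> c)"
proof -
  define w where "w t = metric \<kappa> (c t - p) (c t - p)" for t
  have cQ: "c t \<in> space_form \<kappa>" if "t \<in> {0..1}" for t
    using c that by (auto simp: curves_between_def path_image_def)
  have ends: "c 0 = p" "c 1 = q" and int: "speed \<kappa> c integrable_on {0..1}" and vp: "valid_path c"
    using c by (auto simp: curves_between_def pathstart_def pathfinish_def)
  obtain S where S: "finite S" and cont: "continuous_on {0..1} c"
    and c': "\<And>t. t \<in> {0..1} - S \<Longrightarrow> (c has_vector_derivative vector_derivative c (at t)) (at t)"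
    using vp unfolding valid_path_def piecewise_C1_differentiable_on_def C1_differentiable_on_eq
      vector_derivative_works[symmetric] by blast
  have "\<forall>t\<in>{0..1}. \<exists>s. 0 \<le> s \<and> (\<kappa> = 1 \<longrightarrow> s \<le> pi) \<and> w t = sq_chord \<kappa> s"
    unfolding w_def using exists_radius[OF \<kappa> p cQ] by metis
  then obtain s where s: "\<And>t. t \<in> {0..1} \<Longrightarrow> 0 \<le> s t" "\<And>t. t \<in> {0..1} \<Longrightarrow> \<kappa> = 1 \<Longrightarrow> s t \<le> pi"
    "\<And>t. t \<in> {0..1} \<Longrightarrow> w t = sq_chord \<kappa> (s t)" by metis
  define v where "v t = vector_derivative c (at t)" for t
  \<comment> \<open>At the finitely many exceptional parameters the integrand is free, so it is chosen to be the speed.\<close>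
  define f' where "f' t = (if t \<in> S \<union> {0, 1} then speed \<kappa> c t else h' (s t) * (2 * metric \<kappa> (c t - p) (v t)))" for t
  have "((\<lambda>t. f' t) has_integral h (w 1) - h (w 0)) {0..1}"
  proof (rule fundamental_theorem_of_calculus_interior_strong[where S = "S \<union> {0, 1}"])
    fix t :: real assume t: "t \<in> {0<..<1} - (S \<union> {0, 1})"
    have cv: "(c has_vector_derivative v t) (at t)" using c'[of t] t by (auto simp: v_def)
    have "((\<lambda>t. c t - p) has_vector_derivative v t) (at t)"
      using cv by (auto intro!: derivative_eq_intros)
    from has_vector_derivative_metric[OF this this, of \<kappa>]
    have wd: "(w has_real_derivative 2 * metric \<kappa> (c t - p) (v t)) (at t)"
      unfolding w_def[abs_def] using metric_commute[of \<kappa> "v t"]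
      by (simp add: has_real_derivative_iff_has_vector_derivative)
    have "(h has_real_derivative h' (s t)) (at (w t))"
      using h[of "s t"] s[of t] t by auto
    from DERIV_chain2[OF this wd]
    show "((\<lambda>t. h (w t)) has_vector_derivative f' t) (at t)"
      using t by (simp add: f'_def has_real_derivative_iff_has_vector_derivative)
  next
    have wc: "continuous_on {0..1} w"
      unfolding w_def using cont
      by (intro bounded_bilinear.continuous_on[OF bounded_bilinear_metric] continuous_intros)
    have hc: "continuous_on (w ` {0..1}) h"
    proof (intro continuous_at_imp_continuous_on ballI)
      fix y assume "y \<in> w ` {0..1}"
      then obtain t where "t \<in> {0..1}" "y = w t" by auto
      then show "isCont h y" using h[of "s t"] s[of t] DERIV_isCont by auto
    qed
    show "continuous_on {0..1} (\<lambda>t. h (w t))"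
      using continuous_on_compose[OF wc hc] by (simp add: comp_def)
  qed (use S in auto)
  moreover have "f' t \<le> speed \<kappa> c t" if t: "t \<in> {0..1}" for t
  proof (cases "t \<in> S \<union> {0, 1}")
    case False
    define P where "P = cs \<kappa> (s t) *\<^sub>R c t - p"
    have "w t = sq_chord \<kappa> (s t)" using s t by auto
    then have P: "P \<in> tangent_space \<kappa> (c t)" "metric \<kappa> P P = (sn \<kappa> (s t))\<^sup>2"
      unfolding P_def w_def by (rule radial_vector[OF \<kappa> p cQ[OF t]])+
    have t01: "t \<in> {0<..<1}" using False t by auto
    have vT: "v t \<in> tangent_space \<kappa> (c t)"
    proof -
      have "(c has_derivative (\<lambda>s. s *\<^sub>R v t)) (at t)"
        using c'[of t] False t unfolding v_def has_vector_derivative_def by blast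
      moreover have "accumulates_along {0<..<1} t 1"
        by (rule accumulates_along_interval) (use t01 in \<open>auto simp: is_interval_convex_1\<close>)
      moreover have "c z \<in> space_form \<kappa>" if "z \<in> {0<..<1}" for z using that by (intro cQ) auto
      ultimately show ?thesis using space_form_derivative_tangent[of c _ t] t01 by fastforce
    qed
    have "metric \<kappa> (c t - p) (v t) = metric \<kappa> P (v t) + (1 - cs \<kappa> (s t)) * metric \<kappa> (c t) (v t)"
      unfolding P_def by (simp add: metric_simps algebra_simps)
    also have "(1 - cs \<kappa> (s t)) * metric \<kappa> (c t) (v t) = 0"
      using sq_chord_cs[OF \<kappa>, of "s t"] curvature_metric_tangent[OF \<kappa> vT]
      by (metis mult_eq_0_iff zero_neq_numeral mult_zero_left)
    finally have e: "metric \<kappa> (c t - p) (v t) = metric \<kappa> P (v t)" by simp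
    have vv: "metric \<kappa> (v t) (v t) = (speed \<kappa> c t)\<^sup>2" "0 \<le> speed \<kappa> c t"
      using metric_nonneg[OF \<kappa> cQ[OF t] vT] by (simp_all add: speed_def v_def Let_def)
    have sn0: "0 \<le> sn \<kappa> (s t)" using s t by (intro sn_nonneg) auto
    have "(metric \<kappa> P (v t))\<^sup>2 \<le> (sn \<kappa> (s t) * speed \<kappa> c t)\<^sup>2"
      using metric_Cauchy_Schwarz[OF \<kappa> cQ[OF t] P(1) vT] by (simp add: P vv power_mult_distrib)
    then have "metric \<kappa> P (v t) \<le> sn \<kappa> (s t) * speed \<kappa> c t"
      by (rule power2_le_imp_le) (use sn0 vv in simp)
    then have "h' (s t) * (2 * metric \<kappa> (c t - p) (v t)) \<le> h' (s t) * (2 * (sn \<kappa> (s t) * speed \<kappa> c t))"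
      using h[of "s t"] s[of t] t unfolding e by (intro mult_left_mono) auto
    also have "\<dots> = (h' (s t) * (2 * sn \<kappa> (s t))) * speed \<kappa> c t" by simp
    also have "\<dots> \<le> 1 * speed \<kappa> c t"
      using h[of "s t"] s[of t] t vv by (intro mult_right_mono) auto
    finally show ?thesis using False by (simp add: f'_def)
  qed (auto simp: f'_def)
  ultimately have "h (w 1) - h (w 0) \<le> integral {0..1} (speed \<kappa> c)"
    using has_integral_le[OF _ integrable_integral[OF int]] by blast
  then show ?thesis by (simp add: w_def ends metric_zero_left)
qed

lemma continuous_bound_at_0:
  fixes G :: "real \<Rightarrow> real"
  assumes "continuous_on {0..1} G" and "\<And>x. 0 < x \<Longrightarrow> x \<le> 1 \<Longrightarrow> G x \<le> L"
  shows "G 0 \<le> L"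
proof -
  have "closure {0<..1::real} = {0..1}" by (rule closure_greaterThanAtMost) simp
  then show ?thesis
    using continuous_le_on_closure[of "{0<..1}" G 0 L] assms by auto
qed

text \<open>The calibrations are smooth approximations of the radius: \<open>sqrt (w + x)\<close>, and \<open>arccos\<close> or \<open>arcosh\<close> of a multiple
  \<open>u cos s\<close> with \<open>u < 1\<close>, or \<open>u cosh s\<close> with \<open>u > 1\<close>, which stays away from the singular values \<open>\<plusminus>1\<close>.
  The bound for the radius is the limit \<open>x \<rightarrow> 0\<close>, \<open>u \<rightarrow> 1\<close>.\<close>

lemma radius_le_length:
  fixes p q :: "real \<times> 'e::euclidean_space"
  assumes \<kappa>: "\<kappa> \<in> {-1, 0, 1}" and p: "p \<in> space_form \<kappa>"
    and s: "0 \<le> s" "\<kappa> = 1 \<Longrightarrow> s \<le> pi" "metric \<kappa> (q - p) (q - p) = sq_chord \<kappa> s"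
    and c: "c \<in> curves_between \<kappa> p q"
  shows "s \<le> integral {0..1} (speed \<kappa> c)" (is "_ \<le> ?L")
proof -
  have chord: "1 - \<kappa> * sq_chord \<kappa> s / 2 = cs \<kappa> s" for s
    using sq_chord_cs[OF \<kappa>, of s] by (simp add: field_simps)
  consider "\<kappa> = 0" | "\<kappa> = 1" | "\<kappa> = -1" using \<kappa> by auto
  then show ?thesis
  proof cases
    case 1
    have w: "sq_chord \<kappa> s = s\<^sup>2" for s using 1 by (simp add: sq_chord_def sn_def power_divide)
    define G where "G x = sqrt (s\<^sup>2 + x) - sqrt x" for x
    have "G 0 \<le> ?L"
    proof (rule continuous_bound_at_0)
      show "continuous_on {0..1} G" unfolding G_def[abs_def] by (intro continuous_intros)
      fix x :: real assume x: "0 < x" "x \<le> 1"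
      have "sqrt (metric \<kappa> (q - p) (q - p) + x) - sqrt (0 + x) \<le> ?L"
      proof (rule length_ge_calibration[OF \<kappa> c p, where h' = "\<lambda>s. 1 / (2 * sqrt (s\<^sup>2 + x))"])
        fix s :: real assume s: "0 \<le> s"
        have pos: "s\<^sup>2 + x > 0" using x by (simp add: add_nonneg_pos)
        have "s \<le> sqrt (s\<^sup>2 + x)" using x by (intro real_le_rsqrt) simp
        then show "((\<lambda>w. sqrt (w + x)) has_real_derivative 1 / (2 * sqrt (s\<^sup>2 + x))) (at (sq_chord \<kappa> s)) \<and>
          0 \<le> 1 / (2 * sqrt (s\<^sup>2 + x)) \<and> 1 / (2 * sqrt (s\<^sup>2 + x)) * (2 * sn \<kappa> s) \<le> 1"
          using pos 1 unfolding w sn_def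
          by (auto intro!: derivative_eq_intros simp: inverse_eq_divide)
      qed
      then show "G x \<le> ?L" by (simp add: G_def s(3) w)
    qed
    then show ?thesis using s(1) by (simp add: G_def)
  next
    case 2
    define G where "G x = arccos ((1 - x) * cos s) - arccos (1 - x)" for x
    have "G 0 \<le> ?L"
    proof (rule continuous_bound_at_0)
      have "\<bar>(1 - x) * cos s\<bar> \<le> 1" if "0 \<le> x" "x \<le> 1" for x
        using that by (simp add: abs_mult mult_le_one)
      then show "continuous_on {0..1} G" unfolding G_def[abs_def]
        by (intro continuous_on_diff continuous_on_arccos continuous_intros) (auto simp: abs_le_iff)
      fix x :: real assume x: "0 < x" "x \<le> 1"
      define u where "u = 1 - x"
      have u: "0 \<le> u" "u < 1" using x by (auto simp: u_def)
      have "arccos (u * (1 - metric \<kappa> (q - p) (q - p) / 2)) - arccos (u * (1 - 0 / 2)) \<le> ?L"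
      proof (rule length_ge_calibration[OF \<kappa> c p,
            where h' = "\<lambda>s. u / 2 * (1 / sqrt (1 - (u * cos s)\<^sup>2))"])
        fix s :: real assume s: "0 \<le> s" "\<kappa> = 1 \<Longrightarrow> s \<le> pi"
        have "\<bar>u * cos s\<bar> \<le> u * 1" unfolding abs_mult using u by (intro mult_mono) auto
        then have b: "\<bar>u * cos s\<bar> < 1" using u by simp
        then have pos: "0 < sqrt (1 - (u * cos s)\<^sup>2)" by (simp add: abs_square_less_1)
        have e: "u * (1 - sq_chord \<kappa> s / 2) = u * cos s" using 2 chord[of s] by (simp add: cs_def)
        have "(arccos has_real_derivative inverse (- sqrt (1 - (u * cos s)\<^sup>2))) (at (u * (1 - sq_chord \<kappa> s / 2)))"
          unfolding e using b by (intro DERIV_arccos) auto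
        then have "((\<lambda>w. arccos (u * (1 - w / 2))) has_real_derivative
            inverse (- sqrt (1 - (u * cos s)\<^sup>2)) * (- u / 2)) (at (sq_chord \<kappa> s))"
          by (rule DERIV_chain2) (auto intro!: derivative_eq_intros)
        moreover have "inverse (- sqrt (1 - (u * cos s)\<^sup>2)) * (- u / 2) = u / 2 * (1 / sqrt (1 - (u * cos s)\<^sup>2))"
          by (simp add: inverse_eq_divide)
        moreover have "u / 2 * (1 / sqrt (1 - (u * cos s)\<^sup>2)) * (2 * sn \<kappa> s) \<le> 1"
        proof -
          have "u\<^sup>2 \<le> 1" using u by (simp add: power_le_one)
          then have "(u * sin s)\<^sup>2 \<le> 1 - (u * cos s)\<^sup>2"
            by (simp add: power_mult_distrib sin_squared_eq algebra_simps)
          then have "u * sin s \<le> sqrt (1 - (u * cos s)\<^sup>2)" by (rule real_le_rsqrt)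
          then show ?thesis using pos 2 by (simp add: sn_def)
        qed
        ultimately show "((\<lambda>w. arccos (u * (1 - w / 2))) has_real_derivative
            u / 2 * (1 / sqrt (1 - (u * cos s)\<^sup>2))) (at (sq_chord \<kappa> s)) \<and>
          0 \<le> u / 2 * (1 / sqrt (1 - (u * cos s)\<^sup>2)) \<and> u / 2 * (1 / sqrt (1 - (u * cos s)\<^sup>2)) * (2 * sn \<kappa> s) \<le> 1"
          using pos u by (simp only:) simp
      qed
      moreover have "1 - metric \<kappa> (q - p) (q - p) / 2 = cos s"
        using chord[of s] 2 s(3) by (simp add: cs_def)
      ultimately show "G x \<le> ?L" by (simp add: G_def u_def)
    qed
    then show ?thesis using s 2 by (simp add: G_def arccos_cos)
  next
    case 3
    define G where "G x = arcosh ((1 + x) * cosh s) - arcosh (1 + x)" for x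
    have "G 0 \<le> ?L"
    proof (rule continuous_bound_at_0)
      have "1 * 1 \<le> (1 + x) * cosh s" if "0 \<le> x" for x
        using that by (intro mult_mono) (auto simp: cosh_real_ge_1)
      then show "continuous_on {0..1} G" unfolding G_def[abs_def]
        by (intro continuous_on_diff continuous_on_arcosh' continuous_intros) auto
      fix x :: real assume x: "0 < x" "x \<le> 1"
      define u where "u = 1 + x"
      have u: "1 < u" using x by (auto simp: u_def)
      have "arcosh (u * (1 + metric \<kappa> (q - p) (q - p) / 2)) - arcosh (u * (1 + 0 / 2)) \<le> ?L"
      proof (rule length_ge_calibration[OF \<kappa> c p,
            where h' = "\<lambda>s. (1 / sqrt ((u * cosh s)\<^sup>2 - 1)) * (u / 2)"])
        fix s :: real assume s: "0 \<le> s"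
        have "1 * 1 < u * cosh s" using u by (intro mult_less_le_imp_less) (auto simp: cosh_real_ge_1)
        then have b: "1 < u * cosh s" by simp
        then have pos: "0 < sqrt ((u * cosh s)\<^sup>2 - 1)" by (simp add: one_less_power)
        have e: "u * (1 + sq_chord \<kappa> s / 2) = u * cosh s" using 3 chord[of s] by (simp add: cs_def)
        have "(arcosh has_real_derivative 1 / sqrt ((u * cosh s)\<^sup>2 - 1)) (at (u * (1 + sq_chord \<kappa> s / 2)))"
          unfolding e by (rule arcosh_real_has_field_derivative[OF b])
        then have "((\<lambda>w. arcosh (u * (1 + w / 2))) has_real_derivative
            1 / sqrt ((u * cosh s)\<^sup>2 - 1) * (u / 2)) (at (sq_chord \<kappa> s))"
          by (rule DERIV_chain2) (auto intro!: derivative_eq_intros)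
        moreover have "1 / sqrt ((u * cosh s)\<^sup>2 - 1) * (u / 2) * (2 * sn \<kappa> s) \<le> 1"
        proof -
          have "1 \<le> u\<^sup>2" using u by (simp add: one_le_power)
          then have "(u * sinh s)\<^sup>2 \<le> (u * cosh s)\<^sup>2 - 1"
            by (simp add: power_mult_distrib cosh_square_eq algebra_simps)
          then have "u * sinh s \<le> sqrt ((u * cosh s)\<^sup>2 - 1)" by (rule real_le_rsqrt)
          then show ?thesis using pos 3 by (simp add: sn_def)
        qed
        ultimately show "((\<lambda>w. arcosh (u * (1 + w / 2))) has_real_derivative
            1 / sqrt ((u * cosh s)\<^sup>2 - 1) * (u / 2)) (at (sq_chord \<kappa> s)) \<and>
          0 \<le> 1 / sqrt ((u * cosh s)\<^sup>2 - 1) * (u / 2) \<and>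
          1 / sqrt ((u * cosh s)\<^sup>2 - 1) * (u / 2) * (2 * sn \<kappa> s) \<le> 1"
          using pos u by simp
      qed
      moreover have "1 + metric \<kappa> (q - p) (q - p) / 2 = cosh s"
        using chord[of s] 3 s(3) by (simp add: cs_def)
      ultimately show "G x \<le> ?L" by (simp add: G_def u_def)
    qed
    then show ?thesis using s by (simp add: G_def arcosh_cosh_real)
  qed
qed

lemma riem_dist_eq:
  fixes p q :: "real \<times> 'e::euclidean_space"
  assumes \<kappa>: "\<kappa> \<in> {-1, 0, 1}" and p: "p \<in> space_form \<kappa>" and q: "q \<in> space_form \<kappa>"
    and s: "0 \<le> s" "\<kappa> = 1 \<Longrightarrow> s \<le> pi" "metric \<kappa> (q - p) (q - p) = sq_chord \<kappa> s"
  shows "riem_dist \<kappa> p q = s"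
proof -
  obtain e where e: "e \<in> tangent_space \<kappa> p" "metric \<kappa> e e = 1" "geodesic \<kappa> p e s = q"
    using exists_geodesic[OF \<kappa> p q s(3)] .
  obtain c where c: "c \<in> curves_between \<kappa> p q" "integral {0..1} (speed \<kappa> c) = s"
    using geodesic_path[OF \<kappa> p e(1,2) s(1)] unfolding e(3) by blast
  note le = radius_le_length[OF \<kappa> p s]
  show ?thesis unfolding riem_dist_def
  proof (rule antisym)
    show "(INF c\<in>curves_between \<kappa> p q. integral {0..1} (speed \<kappa> c)) \<le> s"
      using c le by (intro cINF_lower2[of _ _ c]) (auto intro!: bdd_belowI2[where m = s])
    show "s \<le> (INF c\<in>curves_between \<kappa> p q. integral {0..1} (speed \<kappa> c))"
      using c le by (intro cINF_greatest) auto
  qed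
qed

lemma geodesic_sphere_chord:
  assumes \<kappa>: "\<kappa> \<in> {-1, 0, 1}" and p: "p \<in> space_form \<kappa>" and q: "q \<in> geodesic_sphere \<kappa> p s"
  shows "metric \<kappa> (q - p) (q - p) = sq_chord \<kappa> s"
proof -
  have q': "q \<in> space_form \<kappa>" "riem_dist \<kappa> p q = s" using q by (auto simp: geodesic_sphere_def)
  obtain t where t: "0 \<le> t" "\<kappa> = 1 \<Longrightarrow> t \<le> pi" "metric \<kappa> (q - p) (q - p) = sq_chord \<kappa> t"
    using exists_radius[OF \<kappa> p q'(1)] by metis
  show ?thesis using riem_dist_eq[OF \<kappa> p q'(1) t] q'(2) t(3) by simp
qed

text \<open>The ambient derivative of \<open>radius\<close> of the squared chord is \<open>\<langle>q - p, \<cdot>\<rangle> / sn(s)\<close>, and in general no tangent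
  vector represents it. Adding a multiple of the function \<open>\<langle>x, x\<rangle>\<close>, constant on the space form for \<open>\<kappa> = \<plusminus>1\<close>, corrects the
  normal component. For \<open>\<kappa> = 0\<close> the coefficient \<open>k\<close> is zero. Uniqueness is tested on geodesics through \<open>q\<close>.\<close>

lemma gradient_riem_dist:
  fixes p q :: "real \<times> 'e::euclidean_space"
  assumes \<kappa>: "\<kappa> \<in> {-1, 0, 1}" and p: "p \<in> space_form \<kappa>" and q: "q \<in> space_form \<kappa>"
    and s: "0 < s" "\<kappa> = 1 \<Longrightarrow> s < pi" "metric \<kappa> (q - p) (q - p) = sq_chord \<kappa> s"
  shows "gradient \<kappa> (riem_dist \<kappa> p) q = (1 / sn \<kappa> s) *\<^sub>R (cs \<kappa> s *\<^sub>R q - p)"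
proof -
  define \<rho> where "\<rho> = riem_dist \<kappa> p"
  define G where "G = (1 / sn \<kappa> s) *\<^sub>R (cs \<kappa> s *\<^sub>R q - p)"
  have sn0: "sn \<kappa> s > 0" using s by (intro sn_pos)
  have GT: "G \<in> tangent_space \<kappa> q"
    unfolding G_def by (rule subspace_scale[OF subspace_tangent_space radial_vector(1)[OF \<kappa> p q s(3)]])
  define k where "k = (cs \<kappa> s - 1) / (2 * sn \<kappa> s)"
  define F where "F x = radius \<kappa> (metric \<kappa> (x - p) (x - p)) + k * (metric \<kappa> x x - metric \<kappa> q q)" for x
  have F: "\<rho> x = F x" if x: "x \<in> space_form \<kappa>" for x
  proof -
    obtain t where t: "0 \<le> t" "\<kappa> = 1 \<Longrightarrow> t \<le> pi" "metric \<kappa> (x - p) (x - p) = sq_chord \<kappa> t"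
      using exists_radius[OF \<kappa> p x] by metis
    have "k * (metric \<kappa> x x - metric \<kappa> q q) = 0"
    proof (cases "\<kappa> = 0")
      case False
      then show ?thesis using \<kappa> metric_self[of \<kappa> x] metric_self[of \<kappa> q] x q by auto
    qed (simp add: k_def cs_def)
    then show ?thesis
      using riem_dist_eq[OF \<kappa> p x t] radius_sq_chord[OF \<kappa> t(1,2)] t(3) by (simp add: F_def \<rho>_def)
  qed
  have "((\<lambda>x. x - p) has_derivative (\<lambda>x. x)) (at q)" by (auto intro!: derivative_eq_intros)
  from has_derivative_metric[OF this this, of \<kappa>]
  have "((\<lambda>x. metric \<kappa> (x - p) (x - p)) has_derivative (\<lambda>v. 2 * metric \<kappa> (q - p) v)) (at q)"
    by (simp add: metric_commute[of \<kappa> _ "q - p"])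
  moreover have "(radius \<kappa> has_derivative (*) (1 / (2 * sn \<kappa> s))) (at (metric \<kappa> (q - p) (q - p)))"
    using radius_has_derivative[OF \<kappa> s(1,2)] unfolding s(3) has_field_derivative_def .
  ultimately have d1: "((\<lambda>x. radius \<kappa> (metric \<kappa> (x - p) (x - p))) has_derivative
      (\<lambda>v. 1 / (2 * sn \<kappa> s) * (2 * metric \<kappa> (q - p) v))) (at q)"
    by (rule has_derivative_compose)
  have "((\<lambda>x. x) has_derivative (\<lambda>x. x)) (at q)" by (auto intro!: derivative_eq_intros)
  from has_derivative_metric[OF this this, of \<kappa>]
  have "((\<lambda>x. metric \<kappa> x x) has_derivative (\<lambda>v. 2 * metric \<kappa> q v)) (at q)"
    by (simp add: metric_commute[of \<kappa> _ "q"])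
  then have "((\<lambda>x. k * (metric \<kappa> x x - metric \<kappa> q q)) has_derivative (\<lambda>v. k * (2 * metric \<kappa> q v))) (at q)"
    by (auto intro!: derivative_eq_intros)
  from has_derivative_add[OF d1 this]
  have dF: "(F has_derivative (\<lambda>v. 1 / (2 * sn \<kappa> s) * (2 * metric \<kappa> (q - p) v) + k * (2 * metric \<kappa> q v))) (at q)"
    unfolding F_def[abs_def] .
  have "(\<lambda>v. 1 / (2 * sn \<kappa> s) * (2 * metric \<kappa> (q - p) v) + k * (2 * metric \<kappa> q v)) = metric \<kappa> G"
    unfolding G_def k_def using sn0 by (intro ext) (simp add: metric_simps field_simps)
  with dF have "(F has_derivative metric \<kappa> G) (at q within space_form \<kappa>)"
    using has_derivative_at_withinI by metis
  then have d\<rho>: "(\<rho> has_derivative metric \<kappa> G) (at q within space_form \<kappa>)"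
    using has_derivative_transform[of q "space_form \<kappa>" \<rho> F "metric \<kappa> G"] q F by simp
  have uniq: "G' = G" if G': "G' \<in> tangent_space \<kappa> q" "(\<rho> has_derivative metric \<kappa> G') (at q within space_form \<kappa>)" for G'
  proof (rule ccontr)
    assume "G' \<noteq> G"
    define Z where "Z = G' - G"
    have ZT: "Z \<in> tangent_space \<kappa> q" and "Z \<noteq> 0"
      unfolding Z_def using subspace_diff[OF subspace_tangent_space G'(1) GT] \<open>G' \<noteq> G\<close> by auto
    then have pos: "0 < metric \<kappa> Z Z" using metric_pos[OF \<kappa> q] by blast
    define e where "e = (1 / sqrt (metric \<kappa> Z Z)) *\<^sub>R Z"
    have e: "e \<in> tangent_space \<kappa> q" "metric \<kappa> e e = 1"
      unfolding e_def using pos subspace_scale[OF subspace_tangent_space ZT] by (auto simp: metric_simps)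
    have c0: "geodesic \<kappa> q e 0 = q" by (simp add: geodesic_def)
    have dc: "(geodesic \<kappa> q e has_derivative (\<lambda>t. t *\<^sub>R e)) (at 0)"
      using geodesic_has_derivative[OF \<kappa>, of q e 0 UNIV]
      by (simp add: has_vector_derivative_def)
    have im: "geodesic \<kappa> q e ` UNIV \<subseteq> space_form \<kappa>" using geodesic_in_space_form[OF \<kappa> q e] by auto
    have "((\<lambda>t. \<rho> (geodesic \<kappa> q e t)) has_derivative (\<lambda>t. metric \<kappa> H (t *\<^sub>R e))) (at 0)"
      if "(\<rho> has_derivative metric \<kappa> H) (at q within space_form \<kappa>)" for H
      using has_derivative_in_compose[OF dc has_derivative_subset[OF _ im]] that unfolding c0 by blast
    from has_derivative_unique[OF this[OF G'(2)] this[OF d\<rho>]]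
    have "metric \<kappa> G' (1 *\<^sub>R e) = metric \<kappa> G (1 *\<^sub>R e)" by meson
    then have "metric \<kappa> Z e = 0" by (simp add: Z_def metric_simps)
    then show False using pos by (simp add: e_def metric_simps)
  qed
  show ?thesis
    unfolding gradient_def \<rho>_def[symmetric] G_def[symmetric]
  proof (rule the_equality)
    show "G \<in> tangent_space \<kappa> q \<and> (\<rho> has_derivative metric \<kappa> G) (at q within space_form \<kappa>)"
      by (rule conjI[OF GT d\<rho>])
  next
    fix G' assume "G' \<in> tangent_space \<kappa> q \<and> (\<rho> has_derivative metric \<kappa> G') (at q within space_form \<kappa>)"
    then show "G' = G" by (elim conjE) (rule uniq)
  qed
qed

section \<open>The boundary condition in a chart\<close>

lemma metric_derivative_along:
  assumes f: "(f has_derivative f') (at y)" and g: "(g has_derivative g') (at y)"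
    and k: "(k has_derivative k') (at y within S)" and v: "accumulates_along S y v"
    and eq: "\<And>z. z \<in> S \<Longrightarrow> metric \<kappa> (f z) (g z) = k z" and y: "y \<in> S"
  shows "metric \<kappa> (f y) (g' v) + metric \<kappa> (f' v) (g y) = k' v"
proof -
  have "((\<lambda>z. metric \<kappa> (f z) (g z)) has_derivative (\<lambda>v. metric \<kappa> (f y) (g' v) + metric \<kappa> (f' v) (g y))) (at y within S)"
    by (rule has_derivative_metric[OF has_derivative_at_withinI[OF f] has_derivative_at_withinI[OF g]])
  from derivative_eq_along[OF this k v eq eq[OF y]] show ?thesis by simp
qed

text \<open>A dimension count: the image of \<open>L\<close> and the normal \<open>N\<close> together have the dimension of the tangent space.\<close>

lemma normal_decomposition:
  fixes L :: "'v::euclidean_space \<Rightarrow> real \<times> 'e::euclidean_space"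
  assumes "DIM('e) = DIM('v) + 1" and q: "q \<in> space_form \<kappa>"
    and L: "linear L" "inj L" "\<And>Z. L Z \<in> tangent_space \<kappa> q"
    and N: "N \<in> tangent_space \<kappa> q" "metric \<kappa> N N = 1" "\<And>Z. metric \<kappa> N (L Z) = 0"
    and X: "X \<in> tangent_space \<kappa> q"
  obtains Z where "X = L Z + metric \<kappa> X N *\<^sub>R N"
proof -
  define J where "J u = L (fst u) + snd u *\<^sub>R N" for u :: "'v \<times> real"
  have lin: "linear J"
    unfolding J_def[abs_def] by (intro linearI) (auto simp: linear_add[OF L(1)] linear_scale[OF L(1)] algebra_simps)
  have snd: "metric \<kappa> (J u) N = snd u" for u
    unfolding J_def using N by (simp add: metric_simps metric_commute[of \<kappa> "L _" N])
  have inj: "inj J"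
  proof (rule injI)
    fix u w assume e: "J u = J w"
    then have s: "snd u = snd w" using snd by metis
    then have "L (fst u) = L (fst w)" using e by (simp add: J_def)
    then show "u = w" using s injD[OF L(2)] by (simp add: prod_eq_iff)
  qed
  have sub: "range J \<subseteq> tangent_space \<kappa> q"
    unfolding J_def using L(3) N(1)
    by (auto intro!: subspace_add subspace_scale subspace_tangent_space)
  have "(fst q, \<kappa> *\<^sub>R snd q) \<noteq> 0"
    using q by (auto simp: space_form_def zero_prod_def)
  then have "dim (tangent_space \<kappa> q) = DIM('e)"
    unfolding tangent_space_hyperplane using dim_hyperplane by fastforce
  moreover have "dim (range J) = DIM('v \<times> real)" using dim_image_eq[OF lin, of UNIV] inj by simp
  ultimately have "range J = tangent_space \<kappa> q"
    using assms(1) subspace_dim_equal[OF _ subspace_tangent_space sub]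
      linear_subspace_image[OF lin subspace_UNIV] by simp
  then obtain u where u: "X = J u" using X by blast
  show ?thesis by (rule that[of "fst u"]) (metis snd u J_def)
qed

text \<open>Here \<open>g\<close> and \<open>h\<close> extend the family and its normals in a chart, \<open>y\<close> is a parameter together with the
  coordinates of a boundary point, \<open>S\<close> is the part of the chart where \<open>g\<close> and \<open>h\<close> are the given maps, and \<open>B\<close> its boundary part.
  The vector \<open>n\<close> is normal to the boundary hyperplane. The first two summands of the conclusion are \<open>\<partial>\<^sub>\<eta> \<phi>\<close>.\<close>

lemma robin_condition_local:
  fixes g h :: "real \<times> 'v::euclidean_space \<Rightarrow> real \<times> 'e::euclidean_space" and r \<gamma> :: "real \<Rightarrow> real"
    and g' :: "real \<times> 'v \<Rightarrow> real \<times> 'v \<Rightarrow> real \<times> 'e"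
  assumes \<kappa>: "\<kappa> \<in> {-1, 0, 1}" and dim: "DIM('e) = DIM('v) + 1"
    and y: "y \<in> B" and BS: "B \<subseteq> S" and BI: "fst ` B \<subseteq> I"
    and dS: "\<And>Z. accumulates_along S y (0, Z)" and dT: "accumulates_along B y (1, 0)"
    and dB: "\<And>Y. Y \<bullet> n = 0 \<Longrightarrow> accumulates_along B y (0, Y)"
    and g: "(g has_derivative g' y) (at y)" and h: "(h has_derivative h') (at y)"
    and g'': "\<And>u. ((\<lambda>z. g' z u) has_derivative g'' u) (at y)" and sym: "\<And>u v. g'' u v = g'' v u"
    and r: "(r has_real_derivative r') (at (fst y) within I)"
    and \<gamma>: "(\<gamma> has_real_derivative \<gamma>') (at (fst y) within I)"
    and gQ: "\<And>z. z \<in> S \<Longrightarrow> g z \<in> space_form \<kappa>"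
    and hT: "\<And>z. z \<in> S \<Longrightarrow> h z \<in> tangent_space \<kappa> (g z)"
    and hh: "\<And>z. z \<in> S \<Longrightarrow> metric \<kappa> (h z) (h z) = 1"
    and hn: "\<And>z Z. z \<in> S \<Longrightarrow> metric \<kappa> (h z) (g' z (0, Z)) = 0"
    and chord: "\<And>z. z \<in> B \<Longrightarrow> metric \<kappa> (g z - p0) (g z - p0) = sq_chord \<kappa> (r (fst z))"
    and angle: "\<And>z. z \<in> B \<Longrightarrow>
       metric \<kappa> (cs \<kappa> (r (fst z)) *\<^sub>R g z - p0) (h z) = sn \<kappa> (r (fst z)) * cos (\<gamma> (fst z))"
    and contact: "cs \<kappa> (r (fst y)) *\<^sub>R g y - p0 =
       sn \<kappa> (r (fst y)) *\<^sub>R (sin (\<gamma> (fst y)) *\<^sub>R g' y (0, \<eta>) + cos (\<gamma> (fst y)) *\<^sub>R h y)"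
    and sn0: "sn \<kappa> (r (fst y)) > 0" and sin0: "sin (\<gamma> (fst y)) > 0"
    and inj: "inj (\<lambda>Z. g' y (0, Z))"
    and \<eta>: "metric \<kappa> (g' y (0, \<eta>)) (g' y (0, \<eta>)) = 1"
      "\<And>Y. Y \<bullet> n = 0 \<Longrightarrow> metric \<kappa> (g' y (0, \<eta>)) (g' y (0, Y)) = 0" "\<eta> \<bullet> n \<noteq> 0"
  defines "X \<equiv> g' y (1, 0)" and "A \<equiv> metric \<kappa> (h' (0, \<eta>)) (g' y (0, \<eta>))"
  shows "metric \<kappa> X (h' (0, \<eta>)) + metric \<kappa> (g'' (1, 0) (0, \<eta>)) (h y)
     - (ct \<kappa> (r (fst y)) / sin (\<gamma> (fst y)) - cot (\<gamma> (fst y)) * A) * metric \<kappa> X (h y)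
     = r' / sin (\<gamma> (fst y)) * (A - ct \<kappa> (r (fst y)) * cos (\<gamma> (fst y))) + \<gamma>'"
proof -
  define a where "a = fst y"
  define E where "E = g' y (0, \<eta>)"
  define \<phi> where "\<phi> = metric \<kappa> X (h y)"
  have yS: "y \<in> S" using y BS by auto
  have dS1: "accumulates_along S y (1, 0)" using dT BS by (rule accumulates_along_mono)
  have gl: "linear (g' y)" "linear h'" using g h has_derivative_linear by blast+
  have hn': "metric \<kappa> (g' y (0, Z)) (h y) = 0" for Z
    using hn[OF yS] metric_commute[of \<kappa> "h y"] by metis
  have h_unit: "metric \<kappa> (h y) (h' v) = 0" if "accumulates_along S y v" for v
    using metric_derivative_along[OF h h has_derivative_const[of 1] that hh yS]
      metric_commute[of \<kappa> "h y" "h' v"] by simp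
  have g_tan: "g' y v \<in> tangent_space \<kappa> (g y)" if "accumulates_along S y v" for v
    by (rule space_form_derivative_tangent[OF g that gQ yS])
  have weingarten: "metric \<kappa> (g'' (0, Z) v) (h y) = - metric \<kappa> (h' v) (g' y (0, Z))" if "accumulates_along S y v" for Z v
    using metric_derivative_along[OF h g'' has_derivative_const[of 0] that hn yS, of Z]
      metric_commute[of \<kappa> "h y" "g'' (0, Z) v"] by simp
  have rfst: "((\<lambda>z. r (fst z)) has_derivative (\<lambda>v. r' * fst v)) (at y within B)"
    and \<gamma>fst: "((\<lambda>z. \<gamma> (fst z)) has_derivative (\<lambda>v. \<gamma>' * fst v)) (at y within B)"
    using has_derivative_in_compose[OF has_derivative_fst[OF has_derivative_ident]
        has_derivative_subset[OF _ BI]] r \<gamma>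
    unfolding has_field_derivative_def by fastforce+
  have cs_r: "((\<lambda>z. cs \<kappa> (r (fst z))) has_derivative (\<lambda>v. - \<kappa> * sn \<kappa> (r a) * (r' * fst v))) (at y within B)"
    and sn_r: "((\<lambda>z. sn \<kappa> (r (fst z))) has_derivative (\<lambda>v. cs \<kappa> (r a) * (r' * fst v))) (at y within B)"
    and chord_r: "((\<lambda>z. sq_chord \<kappa> (r (fst z))) has_derivative (\<lambda>v. 2 * sn \<kappa> (r a) * (r' * fst v))) (at y within B)"
    unfolding a_def
    using DERIV_compose_FDERIV[OF cs_has_derivative[OF \<kappa>] rfst]
      DERIV_compose_FDERIV[OF sn_has_derivative[OF \<kappa>] rfst]
      DERIV_compose_FDERIV[OF sq_chord_has_derivative[OF \<kappa>] rfst]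
    by (simp_all only: mult_ac)
  have rhs: "((\<lambda>z. sn \<kappa> (r (fst z)) * cos (\<gamma> (fst z))) has_derivative
      (\<lambda>v. cs \<kappa> (r a) * (r' * fst v) * cos (\<gamma> a) - sn \<kappa> (r a) * sin (\<gamma> a) * (\<gamma>' * fst v))) (at y within B)"
    using sn_r \<gamma>fst unfolding a_def by (auto intro!: derivative_eq_intros simp: algebra_simps)
  have gp: "((\<lambda>z. g z - p0) has_derivative g' y) (at y)" using g by (auto intro!: derivative_eq_intros)
  have chord': "metric \<kappa> (g y - p0) (g' y v) = sn \<kappa> (r a) * (r' * fst v)" if "accumulates_along B y v" for v
    using metric_derivative_along[OF gp gp chord_r that chord y]
      metric_commute[of \<kappa> "g y - p0" "g' y v"] by simp
  \<comment> \<open>So the term with the derivative of \<open>cs(r)\<close>, which has the factor \<open>\<kappa>\<close>, drops out of the angle condition.\<close>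
  have kgh: "\<kappa> * metric \<kappa> (g y) (h y) = 0" by (rule curvature_metric_tangent[OF \<kappa> hT[OF yS]])
  have angle': "metric \<kappa> (cs \<kappa> (r a) *\<^sub>R g y - p0) (h' v) + cs \<kappa> (r a) * metric \<kappa> (g' y v) (h y)
      = cs \<kappa> (r a) * (r' * fst v) * cos (\<gamma> a) - sn \<kappa> (r a) * sin (\<gamma> a) * (\<gamma>' * fst v)" if v: "accumulates_along B y v" for v
  proof -
    have "((\<lambda>z. metric \<kappa> (cs \<kappa> (r (fst z)) *\<^sub>R g z - p0) (h z)) has_derivative
       (\<lambda>v. metric \<kappa> (cs \<kappa> (r (fst y)) *\<^sub>R g y - p0) (h' v) +
         metric \<kappa> (cs \<kappa> (r (fst y)) *\<^sub>R g' y v + (- \<kappa> * sn \<kappa> (r a) * (r' * fst v)) *\<^sub>R g y - 0) (h y))) (at y within B)"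
      by (rule has_derivative_metric[OF has_derivative_diff[OF has_derivative_scaleR[OF cs_r
              has_derivative_at_withinI[OF g]] has_derivative_const] has_derivative_at_withinI[OF h]])
    from derivative_eq_along[OF this rhs v angle angle[OF y]]
    have "metric \<kappa> (cs \<kappa> (r a) *\<^sub>R g y - p0) (h' v) + cs \<kappa> (r a) * metric \<kappa> (g' y v) (h y)
        - (sn \<kappa> (r a) * (r' * fst v)) * (\<kappa> * metric \<kappa> (g y) (h y))
      = cs \<kappa> (r a) * (r' * fst v) * cos (\<gamma> a) - sn \<kappa> (r a) * sin (\<gamma> a) * (\<gamma>' * fst v)"
      unfolding a_def[symmetric] by (simp add: metric_simps algebra_simps)
    then show ?thesis unfolding kgh by simp
  qed
  have contact_metric: "metric \<kappa> (cs \<kappa> (r a) *\<^sub>R g y - p0) w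
      = sn \<kappa> (r a) * (sin (\<gamma> a) * metric \<kappa> E w + cos (\<gamma> a) * metric \<kappa> (h y) w)" for w
    unfolding contact[folded a_def E_def] by (simp add: metric_simps)
  have principal: "metric \<kappa> (h' (0, Y)) E = 0" if Y: "Y \<bullet> n = 0" for Y
  proof -
    have "sn \<kappa> (r a) * (sin (\<gamma> a) * metric \<kappa> E (h' (0, Y))) = 0"
      using angle'[OF dB[OF Y]] unfolding contact_metric h_unit[OF dS] hn' by simp
    then show ?thesis using sn0 sin0 metric_commute[of \<kappa> E] by (simp add: a_def)
  qed
  have time: "sn \<kappa> (r a) * (sin (\<gamma> a) * metric \<kappa> E (h' (1, 0))) + cs \<kappa> (r a) * \<phi>
      = cs \<kappa> (r a) * r' * cos (\<gamma> a) - sn \<kappa> (r a) * sin (\<gamma> a) * \<gamma>'"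
    using angle'[OF dT] unfolding contact_metric h_unit[OF dS1] \<phi>_def X_def by simp
  have "metric \<kappa> (cs \<kappa> (r a) *\<^sub>R g y - p0) X = metric \<kappa> (g y - p0) X - (1 - cs \<kappa> (r a)) * metric \<kappa> (g y) X"
    by (simp add: metric_simps algebra_simps)
  moreover have "(1 - cs \<kappa> (r a)) * metric \<kappa> (g y) X = 0"
    using sq_chord_cs[OF \<kappa>, of "r a"] curvature_metric_tangent[OF \<kappa> g_tan[OF dS1]]
    unfolding X_def by (metis mult_eq_0_iff zero_neq_numeral mult_zero_left)
  ultimately have "sn \<kappa> (r a) * (sin (\<gamma> a) * metric \<kappa> E X + cos (\<gamma> a) * \<phi>) = sn \<kappa> (r a) * r'"
    using chord'[OF dT] unfolding contact_metric X_def \<phi>_def metric_commute[of \<kappa> "h y"] by simp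
  then have radial: "sin (\<gamma> a) * metric \<kappa> E X + cos (\<gamma> a) * \<phi> = r'"
    using sn0 by (simp add: a_def)
  \<comment> \<open>The tangential part of \<open>X\<close> splits into its conormal part and a part along the boundary.\<close>
  obtain Z where Z: "X = g' y (0, Z) + \<phi> *\<^sub>R h y"
  proof (rule normal_decomposition[OF dim gQ[OF yS], where L = "\<lambda>Z. g' y (0, Z)" and N = "h y" and X = X])
    show "linear (\<lambda>Z. g' y (0, Z))"
      using linear_compose[OF _ gl(1), of "\<lambda>Z. (0, Z)"] by (simp add: comp_def linear_iff)
    show "inj (\<lambda>Z. g' y (0, Z))" by (rule inj)
    show "\<And>Z. g' y (0, Z) \<in> tangent_space \<kappa> (g y)" by (rule g_tan[OF dS])
    show "h y \<in> tangent_space \<kappa> (g y)" "metric \<kappa> (h y) (h y) = 1" "\<And>Z. metric \<kappa> (h y) (g' y (0, Z)) = 0"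
      using hT hh hn yS by auto
    show "X \<in> tangent_space \<kappa> (g y)" unfolding X_def by (rule g_tan[OF dS1])
  qed (auto simp: \<phi>_def)
  define \<mu> where "\<mu> = (Z \<bullet> n) / (\<eta> \<bullet> n)"
  define Y where "Y = Z - \<mu> *\<^sub>R \<eta>"
  have Yn: "Y \<bullet> n = 0" using \<eta>(3) by (simp add: Y_def \<mu>_def inner_diff_left)
  have ZY: "g' y (0, Z) = \<mu> *\<^sub>R E + g' y (0, Y)"
  proof -
    have "(0, Z) = \<mu> *\<^sub>R (0, \<eta>) + (0, Y)" by (simp add: Y_def)
    then show ?thesis unfolding E_def by (metis linear_add[OF gl(1)] linear_scale[OF gl(1)])
  qed
  have EX: "metric \<kappa> E X = \<mu>"
    unfolding Z ZY using \<eta>(1,2) Yn hn' by (simp add: metric_simps E_def)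
  \<comment> \<open>The second fundamental form is symmetric, so \<open>principal\<close> also applies to the derivative along \<open>\<eta>\<close>.\<close>
  have "metric \<kappa> (g' y (0, Y)) (h' (0, \<eta>)) = - metric \<kappa> (g'' (0, Y) (0, \<eta>)) (h y)"
    using weingarten[OF dS, of Y \<eta>] metric_commute[of \<kappa> "h' (0, \<eta>)"] by simp
  also have "\<dots> = metric \<kappa> (h' (0, Y)) E"
    unfolding sym[of "(0, Y)"] weingarten[OF dS] E_def by simp
  finally have "metric \<kappa> (g' y (0, Y)) (h' (0, \<eta>)) = 0" using principal[OF Yn] by simp
  then have XN: "metric \<kappa> X (h' (0, \<eta>)) = \<mu> * A"
    unfolding Z ZY metric_add_left metric_scaleR_left h_unit[OF dS] A_def E_def
    by (simp add: metric_commute)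
  have NN: "metric \<kappa> (g'' (1, 0) (0, \<eta>)) (h y) = - metric \<kappa> E (h' (1, 0))"
    unfolding sym[of "(1, 0)"] weingarten[OF dS1] E_def by (simp add: metric_commute)
  have ct: "ct \<kappa> (r a) = cs \<kappa> (r a) / sn \<kappa> (r a)" by (rule ct_eq)
  have s: "sin (\<gamma> a) \<noteq> 0" "sn \<kappa> (r a) \<noteq> 0" using sin0 sn0 by (auto simp: a_def)
  have \<mu>: "\<mu> = (r' - cos (\<gamma> a) * \<phi>) / sin (\<gamma> a)" using radial s unfolding EX by (simp add: field_simps)
  have EN: "metric \<kappa> E (h' (1, 0)) = (ct \<kappa> (r a) * (r' * cos (\<gamma> a) - \<phi>)) / sin (\<gamma> a) - \<gamma>'"
    using time s unfolding ct by (simp add: field_simps)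
  show ?thesis
    unfolding XN NN EN \<mu> a_def[symmetric] \<phi>_def[symmetric] cot_def
    using s by (simp add: field_simps)
qed

section \<open>Charts\<close>

lemma chart_inv_chart:
  assumes "is_chart M c"
  shows "q \<in> fst c \<Longrightarrow> chart_inv c (snd c q) = q"
proof -
  have "fst c \<subseteq> topspace M" using assms by (auto simp: is_chart_def dest: openin_subset)
  then have "inj_on (snd c) (fst c)"
    using assms homeomorphic_imp_injective_map[of "subtopology M (fst c)" _ "snd c"]
    by (auto simp: is_chart_def Int_absorb1)
  then show "q \<in> fst c \<Longrightarrow> chart_inv c (snd c q) = q" unfolding chart_inv_def by (rule inv_into_f_f)
qed

lemma chart_chart_inv:
  assumes "z \<in> chart_image c"
  shows "chart_inv c z \<in> fst c" "snd c (chart_inv c z) = z"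
  using assms unfolding chart_inv_def chart_image_def by (auto intro: inv_into_into f_inv_into_f)

lemma chart_overlap_open:
  assumes c: "is_chart M c" and d: "is_chart M d"
  shows "openin (top_of_set half_space) (snd c ` (fst c \<inter> fst d))"
proof -
  have "openin (subtopology M (fst c)) (fst c \<inter> fst d)"
    using d by (auto simp: is_chart_def openin_subtopology)
  moreover have "open_map (subtopology M (fst c)) (top_of_set (chart_image c)) (snd c)"
    using c by (auto simp: is_chart_def homeomorphic_imp_open_map)
  ultimately have "openin (top_of_set (chart_image c)) (snd c ` (fst c \<inter> fst d))"
    unfolding open_map_def by blast
  then show ?thesis using c openin_trans by (auto simp: is_chart_def)
qed

lemma inward_inner [simp]: "inward \<bullet> (inward :: 'v::euclidean_space) = 1"
proof -
  have "(inward :: 'v) \<in> Basis" unfolding inward_def by (rule someI_ex) (use nonempty_Basis in blast)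
  then show ?thesis by simp
qed

text \<open>A transition map has an invertible derivative. If it took an interior point of the half space to a
  boundary point, its inward coordinate would have an interior minimum there, so the derivative would not be onto.\<close>

lemma boundary_chart_independent:
  fixes A :: "('m, 'v::euclidean_space) chart set"
  assumes M: "smooth_manifold_with_boundary M A" and c: "c \<in> A" "p \<in> fst c"
    and d: "d \<in> A" "p \<in> fst d" and p: "snd d p \<bullet> inward = 0"
  shows "snd c p \<bullet> inward = 0"
proof (rule ccontr)
  assume ne: "snd c p \<bullet> inward \<noteq> 0"
  have ch: "is_chart M c" "is_chart M d" using M c d by (auto simp: smooth_manifold_with_boundary_def)
  define U where "U = snd c ` (fst c \<inter> fst d)"
  define V where "V = snd d ` (fst d \<inter> fst c)"
  define \<tau> where "\<tau> z = snd d (chart_inv c z)" for z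
  define \<sigma> where "\<sigma> z = snd c (chart_inv d z)" for z
  define x where "x = snd c p"
  have xU: "x \<in> U" using c d by (auto simp: U_def x_def)
  have \<tau>x: "\<tau> x = snd d p" unfolding \<tau>_def x_def chart_inv_chart[OF ch(1) c(2)] ..
  then have \<tau>xV: "\<tau> x \<in> V" using c d by (auto simp: V_def)
  have \<tau>V: "\<tau> z \<in> V" and \<sigma>\<tau>: "\<sigma> (\<tau> z) = z" if "z \<in> U" for z
    using that chart_inv_chart[OF ch(1)] chart_inv_chart[OF ch(2)]
    by (auto simp: U_def V_def \<tau>_def \<sigma>_def)
  have op: "openin (top_of_set half_space) U" "openin (top_of_set half_space) V"
    unfolding U_def V_def by (rule chart_overlap_open; fact)+
  have "smooth_on U \<tau>" "smooth_on V \<sigma>"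
    using M c d unfolding smooth_manifold_with_boundary_def U_def V_def \<tau>_def[abs_def] \<sigma>_def[abs_def] by blast+
  then obtain \<tau>' \<sigma>' where \<tau>': "(\<tau> has_derivative \<tau>') (at x within U)"
    and \<sigma>': "(\<sigma> has_derivative \<sigma>') (at (\<tau> x) within V)"
    using smooth_on_has_derivative xU \<tau>xV by metis
  have "(\<sigma> has_derivative \<sigma>') (at (\<tau> x) within \<tau> ` U)"
    by (rule has_derivative_subset[OF \<sigma>']) (use \<tau>V in auto)
  from has_derivative_in_compose[OF \<tau>' this]
  have "((\<lambda>z. \<sigma> (\<tau> z)) has_derivative (\<lambda>v. \<sigma>' (\<tau>' v))) (at x within U)" .
  from derivative_eq_along[OF this has_derivative_ident accumulates_along_half_space[OF op(1) xU] \<sigma>\<tau> \<sigma>\<tau>[OF xU]]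
  have inv: "\<sigma>' (\<tau>' v) = v" for v by simp
  have "linear \<tau>'" using \<tau>' by (rule has_derivative_linear)
  moreover have "inj \<tau>'" using inv by (metis injI)
  ultimately have "surj \<tau>'" by (rule linear_injective_imp_surjective) simp
  then obtain v where v: "\<tau>' v = inward" by (metis surjD)
  obtain W where W: "open W" "U = half_space \<inter> W" using op(1) by (auto simp: openin_open)
  define U' where "U' = W \<inter> {z. 0 < z \<bullet> inward}"
  have "open U'" unfolding U'_def by (intro open_Int W(1) open_Collect_less continuous_intros)
  have "U' \<subseteq> U" using W by (auto simp: U'_def half_space_def)
  have "x \<in> U'" using xU ne unfolding U'_def W(2) x_def[symmetric] by (auto simp: half_space_def)
  have "(\<tau> has_derivative \<tau>') (at x)"
    using has_derivative_subset[OF \<tau>' \<open>U' \<subseteq> U\<close>] at_within_open[OF \<open>x \<in> U'\<close> \<open>open U'\<close>] by simp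
  then have "((\<lambda>z. \<tau> z \<bullet> inward) has_derivative (\<lambda>v. \<tau>' v \<bullet> inward)) (at x)"
    by (auto intro!: derivative_eq_intros)
  moreover have "\<tau> x \<bullet> inward \<le> \<tau> z \<bullet> inward" if "z \<in> U'" for z
    using \<tau>V[of z] that \<open>U' \<subseteq> U\<close> openin_subset[OF op(2)] p \<tau>x by (auto simp: half_space_def)
  ultimately have "(\<lambda>v. \<tau>' v \<bullet> inward) = (\<lambda>v. 0)"
    using differential_zero_maxmin[OF \<open>x \<in> U'\<close> \<open>open U'\<close>] by blast
  then have "\<tau>' v \<bullet> inward = 0" by meson
  then show False unfolding v by simp
qed

lemma chart_at:
  assumes "smooth_manifold_with_boundary M A" "p \<in> topspace M"
  shows "chart_at A p \<in> A" "p \<in> fst (chart_at A p)"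
proof -
  have "\<exists>c. c \<in> A \<and> p \<in> fst c" using assms by (auto simp: smooth_manifold_with_boundary_def)
  from someI_ex[OF this] show "chart_at A p \<in> A" "p \<in> fst (chart_at A p)" unfolding chart_at_def by auto
qed

lemma differential_eqI:
  assumes M: "smooth_manifold_with_boundary M A" and p: "p \<in> topspace M"
    and c: "c = chart_at A p"
    and f: "((\<lambda>z. f (chart_inv c z)) has_derivative L) (at (snd c p) within chart_image c)"
  shows "differential A f p = L"
proof -
  have cA: "c \<in> A" "p \<in> fst c" using chart_at[OF M p] c by auto
  then have "openin (top_of_set half_space) (chart_image c)"
    using M by (auto simp: smooth_manifold_with_boundary_def is_chart_def)
  then have "accumulates_along (chart_image c) (snd c p) v" for v
    using cA by (intro accumulates_along_half_space) (auto simp: chart_image_def)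
  then show ?thesis
    unfolding differential_def Let_def c[symmetric] by (rule frechet_derivative_within_eqI[OF f])
qed

text \<open>The preferred chart varies with \<open>q\<close>. Derivatives in another chart are values of the differential at
  transformed vectors, so orthogonality to the image of the differential carries over.\<close>

lemma differential_chart:
  fixes A :: "('m, 'v::euclidean_space) chart set"
  assumes M: "smooth_manifold_with_boundary M A" and c: "c \<in> A" "q \<in> fst c"
    and f: "((\<lambda>z. f (chart_inv c z)) has_derivative L) (at (snd c q) within chart_image c)"
    and s: "\<And>d w. d \<in> A \<Longrightarrow> w \<in> chart_image d \<Longrightarrow>
        \<exists>D. ((\<lambda>z. f (chart_inv d z)) has_derivative D) (at w within chart_image d)"
  obtains T where "\<And>Z. L Z = differential A f q (T Z)"
proof -
  define d where "d = chart_at A q"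
  have "q \<in> topspace M" using M c by (auto simp: smooth_manifold_with_boundary_def)
  note d = chart_at[OF M this, folded d_def]
  have ch: "is_chart M c" "is_chart M d" using M c d by (auto simp: smooth_manifold_with_boundary_def)
  define U where "U = snd c ` (fst c \<inter> fst d)"
  define \<tau> where "\<tau> z = snd d (chart_inv c z)" for z
  define x where "x = snd c q"
  have xU: "x \<in> U" using c d by (auto simp: U_def x_def)
  have \<tau>x: "\<tau> x = snd d q" unfolding \<tau>_def x_def chart_inv_chart[OF ch(1) c(2)] ..
  have opU: "openin (top_of_set half_space) U" unfolding U_def by (rule chart_overlap_open; fact)
  have "smooth_on U \<tau>"
    using M c d unfolding smooth_manifold_with_boundary_def U_def \<tau>_def[abs_def] by blast
  then obtain \<tau>' where \<tau>': "(\<tau> has_derivative \<tau>') (at x within U)" using smooth_on_has_derivative xU by metis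
  have "snd d q \<in> chart_image d" using d by (auto simp: chart_image_def)
  then obtain D where D: "((\<lambda>z. f (chart_inv d z)) has_derivative D) (at (\<tau> x) within chart_image d)"
    using s[OF d(1)] unfolding \<tau>x by blast
  have dD: "differential A f q = D"
    by (rule differential_eqI[OF M \<open>q \<in> topspace M\<close> d_def D[unfolded \<tau>x]])
  have sub: "\<tau> ` U \<subseteq> chart_image d"
    using chart_inv_chart[OF ch(1)] by (auto simp: U_def \<tau>_def chart_image_def)
  from has_derivative_in_compose[OF \<tau>' has_derivative_subset[OF D sub]]
  have 1: "((\<lambda>z. f (chart_inv d (\<tau> z))) has_derivative (\<lambda>v. D (\<tau>' v))) (at x within U)" .
  have 2: "((\<lambda>z. f (chart_inv c z)) has_derivative L) (at x within U)"
    unfolding x_def by (rule has_derivative_subset[OF f]) (auto simp: U_def chart_image_def)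
  have eq: "f (chart_inv c z) = f (chart_inv d (\<tau> z))" if "z \<in> U" for z
    using that chart_inv_chart[OF ch(1)] chart_inv_chart[OF ch(2)] by (auto simp: U_def \<tau>_def)
  show ?thesis
    by (rule that[of \<tau>'])
      (use derivative_eq_along[OF 2 1 accumulates_along_half_space[OF opU xU] eq eq[OF xU]] dD in simp)
qed

section \<open>The theorem\<close>

theorem mainTheorem3:
  fixes \<kappa> :: real
    and p0 :: "real \<times> 'e::euclidean_space"
    and M :: "'m topology"
    and \<A> :: "('m, 'v::euclidean_space) chart set"
    and I :: "real set"
    and \<Phi> \<nu> :: "real \<Rightarrow> 'm \<Rightarrow> real \<times> 'e"
    and \<eta> :: "real \<Rightarrow> 'm \<Rightarrow> 'v"
    and r \<gamma> :: "real \<Rightarrow> real"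
  assumes "\<kappa> \<in> {-1, 0, 1}"
    and "DIM('e) = DIM('v) + 1"
    and "p0 \<in> space_form \<kappa>"
    and "is_interval I" and "interior I \<noteq> {}"
    and "smooth_manifold_with_boundary M \<A>" and "compact_space M"
    and "smooth_family I \<A> \<Phi>"
    and "\<And>a. a \<in> I \<Longrightarrow> immersion \<kappa> M \<A> (\<Phi> a)"
    and "smooth_family I \<A> \<nu>"
    and "\<And>a. a \<in> I \<Longrightarrow> unit_normal \<kappa> M \<A> (\<Phi> a) (\<nu> a)"
    and "smooth_on I r"
    and "\<And>a. a \<in> I \<Longrightarrow> 0 < r a"
    and "\<And>a. a \<in> I \<Longrightarrow> \<kappa> = 1 \<Longrightarrow> r a < pi"
    and "\<And>a. a \<in> I \<Longrightarrow> \<Phi> a ` manifold_boundary \<A> \<subseteq> geodesic_sphere \<kappa> p0 (r a)"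
    and "smooth_on I \<gamma>"
    and "\<And>a. a \<in> I \<Longrightarrow> \<gamma> a \<in> {0<..pi/2}"
    and "\<And>a p. a \<in> I \<Longrightarrow> p \<in> manifold_boundary \<A> \<Longrightarrow>
           outward_unit_conormal \<kappa> \<A> (\<Phi> a) p (\<eta> a p)"
    and "\<And>a p. a \<in> I \<Longrightarrow> p \<in> manifold_boundary \<A> \<Longrightarrow>
           gradient \<kappa> (riem_dist \<kappa> p0) (\<Phi> a p) =
             sin (\<gamma> a) *\<^sub>R differential \<A> (\<Phi> a) p (\<eta> a p) + cos (\<gamma> a) *\<^sub>R \<nu> a p"
  shows "\<forall>a\<in>I. \<forall>p\<in>manifold_boundary \<A>.
    (let \<phi> = normal_speed \<kappa> I \<Phi> \<nu> a;
         A\<eta>\<eta> = second_fundamental_form \<kappa> \<A> (\<Phi> a) (\<nu> a) p (\<eta> a p) (\<eta> a p)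
     in differential \<A> \<phi> p (\<eta> a p)
          - (ct \<kappa> (r a) / sin (\<gamma> a) - cot (\<gamma> a) * A\<eta>\<eta>) * \<phi> p
        = vector_derivative r (at a within I) / sin (\<gamma> a) * (A\<eta>\<eta> - ct \<kappa> (r a) * cos (\<gamma> a))
          + vector_derivative \<gamma> (at a within I))"
proof (intro ballI)
  fix a p assume a: "a \<in> I" and pb: "p \<in> manifold_boundary \<A>"
  note \<kappa> = assms(1) and dim = assms(2) and p0 = assms(3) and M = assms(6)
  define n :: 'v where "n = inward"
  have bM: "q \<in> topspace M" if "q \<in> manifold_boundary \<A>" for q
    using that M by (auto simp: manifold_boundary_def smooth_manifold_with_boundary_def)
  define c where "c = chart_at \<A> p"
  have cA: "c \<in> \<A>" "p \<in> fst c" unfolding c_def using chart_at[OF M bM[OF pb]] by auto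
  have chc: "is_chart M c" using M cA by (auto simp: smooth_manifold_with_boundary_def)
  define C where "C = chart_image c"
  have opC: "openin (top_of_set half_space) C" using chc by (auto simp: C_def is_chart_def)
  define x where "x = snd c p"
  have xC: "x \<in> C" using cA by (auto simp: x_def C_def chart_image_def)
  have xp: "chart_inv c x = p" unfolding x_def by (rule chart_inv_chart[OF chc cA(2)])
  have xn: "x \<bullet> n = 0"
    using pb boundary_chart_independent[OF M cA] unfolding manifold_boundary_def x_def n_def by blast
  define y where "y = (a, x)"
  have y: "fst y = a" "snd y = x" by (simp_all add: y_def)
  have yIC: "y \<in> I \<times> C" using a xC by (simp add: y_def)
  obtain W1 g where W1: "open W1" "y \<in> W1" "\<And>k. Ck_on k g W1"
    "\<And>b z. b \<in> I \<Longrightarrow> z \<in> C \<Longrightarrow> (b, z) \<in> W1 \<Longrightarrow> \<Phi> b (chart_inv c z) = g (b, z)"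
    using smooth_on_Times_extension[OF bspec[OF assms(8)[unfolded smooth_family_def] cA(1), folded C_def] yIC]
    by blast
  obtain W2 h where W2: "open W2" "y \<in> W2" "\<And>k. Ck_on k h W2"
    "\<And>b z. b \<in> I \<Longrightarrow> z \<in> C \<Longrightarrow> (b, z) \<in> W2 \<Longrightarrow> \<nu> b (chart_inv c z) = h (b, z)"
    using smooth_on_Times_extension[OF bspec[OF assms(10)[unfolded smooth_family_def] cA(1), folded C_def] yIC]
    by blast
  define W where "W = W1 \<inter> W2"
  have W: "open W" "y \<in> W" using W1 W2 by (auto simp: W_def)
  have \<Phi>g: "\<Phi> b (chart_inv c z) = g (b, z)" and \<nu>h: "\<nu> b (chart_inv c z) = h (b, z)"
    if "b \<in> I" "z \<in> C" "(b, z) \<in> W" for b z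
    using W1(4) W2(4) that by (auto simp: W_def)
  define S where "S = (I \<times> C) \<inter> W"
  define B where "B = {z \<in> S. snd z \<bullet> n = 0}"
  have yB: "y \<in> B" using yIC W xn by (auto simp: B_def S_def y)
  have yS: "y \<in> S" using yB by (simp add: B_def)
  define g' where "g' z v = frechet_derivative g (at z) v" for z v
  define h' where "h' v = frechet_derivative h (at y) v" for v
  define g'' where "g'' u v = frechet_derivative (\<lambda>z. frechet_derivative g (at z) u) (at y) v" for u v
  have g: "(g has_derivative g' z) (at z)" if "z \<in> W" for z
    using Ck_onD[OF W1(3), of z] that unfolding g'_def[abs_def] by (simp add: W_def)
  have h: "(h has_derivative h') (at y)"
    using Ck_onD[OF W2(3), of y] W2(2) unfolding h'_def[abs_def] .
  have g'': "((\<lambda>z. g' z u) has_derivative g'' u) (at y)" for u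
    using Ck_on2D(2)[OF W1(3) W1(2), of u] unfolding g'_def[abs_def] g''_def[abs_def] .
  have sym: "g'' u v = g'' v u" for u v
    unfolding g''_def by (rule Ck_on2_symmetric[OF W1(3) W1(1,2)])
  have cq: "chart_inv c z \<in> fst c" "snd c (chart_inv c z) = z" if "z \<in> C" for z
    using chart_chart_inv[of z c] that by (auto simp: C_def)
  have cM: "chart_inv c z \<in> topspace M" if "z \<in> C" for z
    using cq[OF that] cA M by (auto simp: smooth_manifold_with_boundary_def)
  have cb: "chart_inv c z \<in> manifold_boundary \<A>" if "z \<in> C" "z \<bullet> n = 0" for z
    using cq[OF that(1)] cA(1) that(2) by (auto simp: manifold_boundary_def n_def)
  have I1: "accumulates_along I a 1" by (rule accumulates_along_interval[OF assms(4,5) a])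
  have dS: "accumulates_along S y (0, Z)" for Z
    unfolding S_def using W accumulates_along_Pair_right[OF accumulates_along_half_space[OF opC xC] a] by (auto simp: y_def intro!: accumulates_along_open_Int)
  have dT: "accumulates_along B y (1, 0)"
  proof -
    have "accumulates_along ((I \<times> {x}) \<inter> W) y (1, 0)"
      using W accumulates_along_Pair_left[OF I1, of x "{x}"] by (auto simp: y_def intro!: accumulates_along_open_Int)
    then show ?thesis by (rule accumulates_along_mono) (use xC xn in \<open>auto simp: B_def S_def\<close>)
  qed
  have dB: "accumulates_along B y (0, Y)" if "Y \<bullet> n = 0" for Y
  proof -
    have "accumulates_along {z \<in> C. z \<bullet> inward = 0} x Y"
      by (rule accumulates_along_boundary[OF opC xC]) (use xn that in \<open>auto simp: n_def\<close>)
    then have "accumulates_along ((I \<times> {z \<in> C. z \<bullet> inward = 0}) \<inter> W) y (0, Y)"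
      using W accumulates_along_Pair_right[OF _ a] by (auto simp: y_def intro!: accumulates_along_open_Int)
    then show ?thesis by (rule accumulates_along_mono) (auto simp: B_def S_def n_def)
  qed
  have d\<Phi>: "((\<lambda>z'. \<Phi> b (chart_inv c z')) has_derivative (\<lambda>Z. g' (b, z) (0, Z))) (at z within C)"
    if "(b, z) \<in> S" for b z
    using that by (intro slice_space[OF g W(1)]) (auto simp: S_def \<Phi>g)
  have diff\<Phi>: "differential \<A> (\<Phi> a) p = (\<lambda>Z. g' y (0, Z))"
    using d\<Phi>[of a x] yS by (intro differential_eqI[OF M bM[OF pb] c_def]) (simp add: y_def x_def C_def)
  have diff\<nu>: "differential \<A> (\<nu> a) p = (\<lambda>Z. h' (0, Z))"
  proof (rule differential_eqI[OF M bM[OF pb] c_def])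
    have "((\<lambda>z'. \<nu> a (chart_inv c z')) has_derivative (\<lambda>Z. h' (0, Z))) (at x within C)"
      using h W xC a by (intro slice_space[OF _ W(1)]) (auto simp: y_def \<nu>h)
    then show "((\<lambda>z. \<nu> a (chart_inv c z)) has_derivative (\<lambda>Z. h' (0, Z))) (at (snd c p) within chart_image c)"
      by (simp add: x_def C_def)
  qed
  have vd: "vector_derivative (\<lambda>b. \<Phi> b (chart_inv c z)) (at a within I) = g' (a, z) (1, 0)"
    if "z \<in> C" "(a, z) \<in> W" for z
    using that a accumulates_along_not_bot[OF I1]
    by (intro vector_derivative_within slice_time[OF g W(1)]) (auto simp: \<Phi>g)
  have diff\<phi>: "differential \<A> (normal_speed \<kappa> I \<Phi> \<nu> a) p =
      (\<lambda>Z. metric \<kappa> (g' y (1, 0)) (h' (0, Z)) + metric \<kappa> (g'' (1, 0) (0, Z)) (h y))"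
  proof (rule differential_eqI[OF M bM[OF pb] c_def])
    have "((\<lambda>z'. normal_speed \<kappa> I \<Phi> \<nu> a (chart_inv c z')) has_derivative
      (\<lambda>Z. metric \<kappa> (g' y (1, 0)) (h' (0, Z)) + metric \<kappa> (g'' (1, 0) (0, Z)) (h y))) (at x within C)"
      using has_derivative_metric[OF g'' h, of \<kappa> "(1, 0)"] W xC a
      by (intro slice_space[OF _ W(1)]) (auto simp: y_def \<nu>h vd normal_speed_def)
    then show "((\<lambda>z. normal_speed \<kappa> I \<Phi> \<nu> a (chart_inv c z)) has_derivative
      (\<lambda>Z. metric \<kappa> (g' y (1, 0)) (h' (0, Z)) + metric \<kappa> (g'' (1, 0) (0, Z)) (h y)))
      (at (snd c p) within chart_image c)"
      by (simp add: x_def C_def)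
  qed
  have \<phi>: "normal_speed \<kappa> I \<Phi> \<nu> a p = metric \<kappa> (g' y (1, 0)) (h y)"
    using vd[OF xC] \<nu>h[OF a xC] W unfolding normal_speed_def xp y_def by simp
  have gy: "\<Phi> a p = g y" and hy: "\<nu> a p = h y"
    using \<Phi>g[OF a xC] \<nu>h[OF a xC] W xp by (simp_all add: y_def)
  have gQ: "g z \<in> space_form \<kappa>" if "z \<in> S" for z
    using that assms(9) cM \<Phi>g by (force simp: S_def immersion_def)
  have un: "unit_normal \<kappa> M \<A> (\<Phi> b) (\<nu> b)" if "b \<in> I" for b by (rule assms(11)[OF that])
  have hT: "h z \<in> tangent_space \<kappa> (g z)" and hh: "metric \<kappa> (h z) (h z) = 1" if zS: "z \<in> S" for z
  proof -
    obtain b z' where z: "z = (b, z')" "b \<in> I" "z' \<in> C" "(b, z') \<in> W" using zS by (cases z) (auto simp: S_def)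
    show "h z \<in> tangent_space \<kappa> (g z)" "metric \<kappa> (h z) (h z) = 1"
      using un[OF z(2)] cM[OF z(3)] \<Phi>g[OF z(2-4)] \<nu>h[OF z(2-4)] by (auto simp: unit_normal_def z(1))
  qed
  \<comment> \<open>At points other than \<open>p\<close> the orthogonality is given in another chart.\<close>
  have hn: "metric \<kappa> (h z) (g' z (0, Z)) = 0" if zS: "z \<in> S" for z Z
  proof -
    obtain b z' where z: "z = (b, z')" "b \<in> I" "z' \<in> C" "(b, z') \<in> W" using zS by (cases z) (auto simp: S_def)
    define q where "q = chart_inv c z'"
    have q: "q \<in> fst c" "snd c q = z'" "q \<in> topspace M" using cq[OF z(3)] cM[OF z(3)] by (auto simp: q_def)
    have "((\<lambda>z. \<Phi> b (chart_inv c z)) has_derivative (\<lambda>Z. g' z (0, Z))) (at (snd c q) within chart_image c)"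
      using d\<Phi>[of b z'] zS unfolding q(2) z(1) C_def .
    moreover have "\<exists>L. ((\<lambda>w. \<Phi> b (chart_inv d w)) has_derivative L) (at w within chart_image d)"
      if "d \<in> \<A>" "w \<in> chart_image d" for d w
      using smooth_on_slice[of I "chart_image d" "\<lambda>b w. \<Phi> b (chart_inv d w)"] assms(8) that z(2)
      unfolding smooth_family_def by blast
    ultimately obtain T where "g' z (0, Z) = differential \<A> (\<Phi> b) q (T Z)" for Z
      using differential_chart[OF M cA(1) q(1), of "\<Phi> b"] by metis
    then show ?thesis
      using un[OF z(2)] q(3) \<nu>h[OF z(2-4)] unfolding unit_normal_def z(1) q_def by metis
  qed
  have r: "(r has_real_derivative vector_derivative r (at a within I)) (at (fst y) within I)"
    and \<gamma>: "(\<gamma> has_real_derivative vector_derivative \<gamma> (at a within I)) (at (fst y) within I)"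
    unfolding y by (rule smooth_on_real_derivative[OF assms(12) a] smooth_on_real_derivative[OF assms(16) a])+
  have rpos: "0 < sn \<kappa> (r b)" if "b \<in> I" for b using assms(13,14) that by (intro sn_pos) auto
  have sph: "metric \<kappa> (\<Phi> b q - p0) (\<Phi> b q - p0) = sq_chord \<kappa> (r b)"
    if "b \<in> I" "q \<in> manifold_boundary \<A>" for b q
    using geodesic_sphere_chord[OF \<kappa> p0] assms(15)[OF that(1)] that(2) by blast
  have con: "cs \<kappa> (r b) *\<^sub>R \<Phi> b q - p0 =
      sn \<kappa> (r b) *\<^sub>R (sin (\<gamma> b) *\<^sub>R differential \<A> (\<Phi> b) q (\<eta> b q) + cos (\<gamma> b) *\<^sub>R \<nu> b q)"
    if b: "b \<in> I" and q: "q \<in> manifold_boundary \<A>" for b q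
  proof -
    have "\<Phi> b q \<in> space_form \<kappa>" using assms(9)[OF b] bM[OF q] by (auto simp: immersion_def)
    from gradient_riem_dist[OF \<kappa> p0 this assms(13)[OF b] assms(14)[OF b] sph[OF b q]] assms(19)[OF b q]
    have "(1 / sn \<kappa> (r b)) *\<^sub>R (cs \<kappa> (r b) *\<^sub>R \<Phi> b q - p0) =
      sin (\<gamma> b) *\<^sub>R differential \<A> (\<Phi> b) q (\<eta> b q) + cos (\<gamma> b) *\<^sub>R \<nu> b q" by simp
    from arg_cong[OF this, of "\<lambda>v. sn \<kappa> (r b) *\<^sub>R v"] show ?thesis using rpos[OF b] by simp
  qed
  have Bz: "\<exists>b z'. z = (b, z') \<and> b \<in> I \<and> chart_inv c z' \<in> manifold_boundary \<A> \<and>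
      chart_inv c z' \<in> topspace M \<and> \<Phi> b (chart_inv c z') = g z \<and> \<nu> b (chart_inv c z') = h z" if "z \<in> B" for z
    using that cb cM \<Phi>g \<nu>h by (auto simp: B_def S_def)
  have chord: "metric \<kappa> (g z - p0) (g z - p0) = sq_chord \<kappa> (r (fst z))" if "z \<in> B" for z
    using Bz[OF that] sph by force
  have angle: "metric \<kappa> (cs \<kappa> (r (fst z)) *\<^sub>R g z - p0) (h z) = sn \<kappa> (r (fst z)) * cos (\<gamma> (fst z))"
    if zB: "z \<in> B" for z
  proof -
    obtain b z' where z: "z = (b, z')" "b \<in> I" "chart_inv c z' \<in> manifold_boundary \<A>"
      "chart_inv c z' \<in> topspace M" "\<Phi> b (chart_inv c z') = g z" "\<nu> b (chart_inv c z') = h z"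
      using Bz[OF zB] by blast
    have hE: "metric \<kappa> (h z) (h z) = 1" "metric \<kappa> (differential \<A> (\<Phi> b) (chart_inv c z') w) (h z) = 0" for w
      using un[OF z(2)] z(4,6) metric_commute[of \<kappa> "h z"] unfolding unit_normal_def by metis+
    show ?thesis
      using con[OF z(2,3)] hE unfolding z(5,6) by (simp add: z(1) metric_simps)
  qed
  have contact: "cs \<kappa> (r (fst y)) *\<^sub>R g y - p0 =
       sn \<kappa> (r (fst y)) *\<^sub>R (sin (\<gamma> (fst y)) *\<^sub>R g' y (0, \<eta> a p) + cos (\<gamma> (fst y)) *\<^sub>R h y)"
    using con[OF a pb] unfolding gy hy diff\<Phi> y .
  have sin0: "sin (\<gamma> (fst y)) > 0"
    using assms(17)[OF a] by (intro sin_gt_zero) (auto simp: y)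
  have inj: "inj (\<lambda>Z. g' y (0, Z))"
    using assms(9)[OF a] bM[OF pb] unfolding immersion_def diff\<Phi>[symmetric] by blast
  have \<eta>: "metric \<kappa> (g' y (0, \<eta> a p)) (g' y (0, \<eta> a p)) = 1"
      "\<And>Y. Y \<bullet> n = 0 \<Longrightarrow> metric \<kappa> (g' y (0, \<eta> a p)) (g' y (0, Y)) = 0" "\<eta> a p \<bullet> n \<noteq> 0"
    using assms(18)[OF a pb] unfolding outward_unit_conormal_def diff\<Phi> n_def by auto
  have "\<kappa> * metric \<kappa> (g y) (g' y (0, \<eta> a p)) = 0"
    by (rule curvature_metric_tangent[OF \<kappa> space_form_derivative_tangent[OF g[OF W(2)] dS gQ yS]])
  then have A: "second_fundamental_form \<kappa> \<A> (\<Phi> a) (\<nu> a) p (\<eta> a p) (\<eta> a p)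
      = metric \<kappa> (h' (0, \<eta> a p)) (g' y (0, \<eta> a p))"
    unfolding second_fundamental_form_def cov_deriv_def tangent_proj_def diff\<Phi> diff\<nu> gy
    by (auto simp: metric_simps)
  have BS: "B \<subseteq> S" and BI: "fst ` B \<subseteq> I" by (auto simp: B_def S_def)
  note main = robin_condition_local[OF \<kappa> dim yB BS BI dS dT dB g[OF W(2)] h g'' sym r \<gamma> gQ hT hh hn
      chord angle contact _ sin0 inj \<eta>]
  have "0 < sn \<kappa> (r (fst y))" unfolding y by (rule rpos[OF a])
  from main[OF _ _ _ _ _ _ _ this]
  show "let \<phi> = normal_speed \<kappa> I \<Phi> \<nu> a;
         A\<eta>\<eta> = second_fundamental_form \<kappa> \<A> (\<Phi> a) (\<nu> a) p (\<eta> a p) (\<eta> a p)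
     in differential \<A> \<phi> p (\<eta> a p)
          - (ct \<kappa> (r a) / sin (\<gamma> a) - cot (\<gamma> a) * A\<eta>\<eta>) * \<phi> p
        = vector_derivative r (at a within I) / sin (\<gamma> a) * (A\<eta>\<eta> - ct \<kappa> (r a) * cos (\<gamma> a))
          + vector_derivative \<gamma> (at a within I)"
    unfolding Let_def A \<phi> diff\<phi> y by simp
qed

end
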